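(* Let $\mathcal{A}\subset\mathbb{Z}^d$ be a primitive finite collection of exponent vectors, let $w=(w_{\mathbf a}\mid\mathbf a\in\mathcal{A})\in\mathbb{R}_{>0}^{\mathcal{A}}$ be a system of positive weights, and define the Laurent polynomial $$f=f_{\mathcal{A},w}:=\sum_{\mathbf a\in\mathcal{A}}w_{\mathbf a}x^{\mathbf a}.$$ A toric patch of shape $(\mathcal{A},w)$ has rational linear precision if and only if the rational map $\psi_{\mathcal{A},w}\colon\mathbb{C}^d\dashrightarrow\mathbb{C}^d$ defined by $$\frac1f\Bigl(x_1\frac{\partial}{\partial x_1}f,\;x_2\frac{\partial}{\partial x_2}f,\;\dotsc,\;x_d\frac{\partial}{\partial x_d}f\Bigr)$$ is a birational isomorphism.
   Context: For $\mathbf a=(a_1,\dotsc,a_d)\in\mathbb{Z}^d$, $x^{\mathbf a}:=x_1^{a_1}\dotsb x_d^{a_d}$. The set $\mathcal{A}$ is primitive if it affinely spans $\mathbb{Z}^d$ (every element of $\mathbb{Z}^d$ is an integer affine combination of elements of $\mathcal{A}$); its convex hull $\Delta$ then has dimension $d$. A (parametric) patch indexed by $\mathcal{A}$ is a collection $\{\beta_{\mathbf a}\mid\mathbf a\in\mathcal{A}\}$ of non-negative real-valued functions (blending functions), smooth where defined, with common domain $\Delta$, that do not vanish simultaneously at any point of $\Delta$. They may be normalized by dividing by $\sum_{\mathbf b}\beta_{\mathbf b}$, so that they sum to $1$. The (normalized) patch has linear precision if for every affine function $\Lambda$ on $\mathbb{R}^d$, $\Lambda(x)=\sum_{\mathbf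 a}\beta_{\mathbf a}(x)\Lambda(\mathbf a)$ for all $x\in\Delta$. Its tautological map is $\tau\colon\Delta\to\Delta$, $\tau(x)=\sum_{\mathbf a}\beta_{\mathbf a}(x)\mathbf a$ (normalized $\beta_{\mathbf a}$); the patch is proper if $\tau$ is a homeomorphism. The reparametrization by a homeomorphism $\psi\colon\Delta\to\Delta$ is the patch $\{\beta_{\mathbf a}\circ\psi\}$. A proper patch has a unique reparametrization with linear precision (namely by $\psi=\tau^{-1}$). A patch has rational linear precision if it is proper and its reparametrization having linear precision has blending functions that are rational functions (quotients of polynomials). Let $\mathbb{R}\mathbb{P}^{\mathcal{A}}$ be the real projective space with homogeneous coordinates indexed by $\mathcal{A}$, and let $X_{\mathcal{A},w}\subset\mathbb{R}\mathbb{P}^{\mathcal{A}}$ be the closure of the image of $\mathbb{R}_{>0}^d$ under $x\mapsto[w_{\mathbf a}x^{\mathbf a}\mid\mathbf a\in\mathcal{A}]$. A toric patch of shape $(\mathcal{A},w)$ is any patch $\{\beta_{\mathbf a}\mid\mathbf a\in\mathcal{A}\}$ such that the image of $\Delta$ under $x\mapsto[\beta_{\mathbf a}(x)\mid\mathbf a\in\mathcal{A}]$ equals $X_{\mathcal{A},w}$. A rational map is a birational isomorphism if it has an inverse rational map, the two composites being the identity where they are defined.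
   Formalization: The toric patch is additionally assumed to be proper; without this the claim fails, e.g. for d=1, A={0,1}, w=1 and blending functions 1-g, g with g a smooth surjective non-injective self-map of [0,1]. *)

theory Defs
  imports "HOL-Analysis.Analysis"
begin

section \<open>Exponent vectors, Laurent monomials and polynomials\<close>

definition primitive :: "(int ^ 'n) set \<Rightarrow> bool" where
  "primitive A \<longleftrightarrow>
     (\<forall>z. \<exists>c :: int ^ 'n \<Rightarrow> int. (\<Sum>a\<in>A. c a) = 1 \<and> (\<Sum>a\<in>A. c a *s a) = z)"

definition real_vec :: "int ^ 'n \<Rightarrow> real ^ 'n" where
  "real_vec a = (\<chi> i. of_int (a $ i))"

definition Delta :: "(int ^ 'n) set \<Rightarrow> (real ^ 'n) set" where
  "Delta A = convex hull (real_vec ` A)"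

definition laurent_monomial :: "'k::field ^ 'n \<Rightarrow> int ^ 'n \<Rightarrow> 'k" where
  "laurent_monomial x a = (\<Prod>i\<in>UNIV. x $ i powi a $ i)"

definition laurent_poly ::
  "(int ^ 'n) set \<Rightarrow> (int ^ 'n \<Rightarrow> real) \<Rightarrow> complex ^ 'n \<Rightarrow> complex" where
  "laurent_poly A w x = (\<Sum>a\<in>A. of_real (w a) * laurent_monomial x a)"

definition partial_deriv ::
  "'n \<Rightarrow> (complex ^ 'n \<Rightarrow> complex) \<Rightarrow> complex ^ 'n \<Rightarrow> complex" where
  "partial_deriv i f x = deriv (\<lambda>t. f (\<chi> j. if j = i then t else x $ j)) (x $ i)"

text \<open>
  Polynomials in the coordinates, as functions. The coefficient field will only be the reals or
  the complex numbers, so a polynomial is nonzero iff its function is not identically zero.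
\<close>

definition polynomial_fun :: "('k::field ^ 'n \<Rightarrow> 'k) \<Rightarrow> bool" where
  "polynomial_fun p \<longleftrightarrow>
     (\<exists>(M :: (nat ^ 'n) set) c. finite M \<and>
        p = (\<lambda>x. \<Sum>m\<in>M. c m * (\<Prod>i\<in>UNIV. x $ i ^ m $ i)))"


section \<open>Rational maps and birational isomorphisms\<close>

text \<open>
  A rational map is represented by a nonempty principal Zariski-open set \<open>U\<close>, the complement of
  the zero set of a polynomial, together with a function \<open>F\<close> given on \<open>U\<close> by quotients of
  polynomials with nonvanishing denominators. Values of \<open>F\<close> outside \<open>U\<close> are irrelevant, and
  \<open>U\<close> need not be the largest possible domain of definition.
\<close>

definition rational_map :: "('k::field ^ 'n) set \<Rightarrow> ('k ^ 'n \<Rightarrow> 'k ^ 'm) \<Rightarrow> bool" where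
  "rational_map U F \<longleftrightarrow>
     U \<noteq> {} \<and>
     (\<exists>g. polynomial_fun g \<and> U = {x. g x \<noteq> 0}) \<and>
     (\<forall>i. \<exists>p q. polynomial_fun p \<and> polynomial_fun q \<and>
        (\<forall>x\<in>U. q x \<noteq> 0 \<and> F x $ i = p x / q x))"

text \<open>
  The two conditions \<open>F ` U \<inter> V \<noteq> {}\<close> and \<open>G ` V \<inter> U \<noteq> {}\<close> say that the composites exist as
  rational maps: their domains \<open>{x \<in> U. F x \<in> V}\<close> and \<open>{y \<in> V. G y \<in> U}\<close> are again principal
  Zariski-open, so they are dense as soon as they are nonempty. Without these conditions
  ``identity where defined'' could hold vacuously.
\<close>

definition birational_isomorphism ::
  "('k::field ^ 'n) set \<Rightarrow> ('k ^ 'n \<Rightarrow> 'k ^ 'm) \<Rightarrow> bool" where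
  "birational_isomorphism U F \<longleftrightarrow>
     rational_map U F \<and>
     (\<exists>V G. rational_map V G \<and>
        F ` U \<inter> V \<noteq> {} \<and> G ` V \<inter> U \<noteq> {} \<and>
        (\<forall>x\<in>U. F x \<in> V \<longrightarrow> G (F x) = x) \<and>
        (\<forall>y\<in>V. G y \<in> U \<longrightarrow> F (G y) = y))"

definition psi_map ::
  "(int ^ 'n) set \<Rightarrow> (int ^ 'n \<Rightarrow> real) \<Rightarrow> complex ^ 'n \<Rightarrow> complex ^ 'n" where
  "psi_map A w x =
     (\<chi> i. (x $ i * partial_deriv i (laurent_poly A w) x) / laurent_poly A w x)"

text \<open>
  The points of the algebraic torus where the formula for \<^const>\<open>psi_map\<close> makes sense; the
  coordinates must be nonzero because the exponents may be negative.
\<close>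

definition psi_dom ::
  "(int ^ 'n) set \<Rightarrow> (int ^ 'n \<Rightarrow> real) \<Rightarrow> (complex ^ 'n) set" where
  "psi_dom A w = {x. (\<forall>i. x $ i \<noteq> 0) \<and> laurent_poly A w x \<noteq> 0}"


section \<open>The real projective space with coordinates indexed by a set\<close>

definition nonzero_coords :: "'a set \<Rightarrow> ('a \<Rightarrow> real) set" where
  "nonzero_coords A = {v \<in> A \<rightarrow>\<^sub>E UNIV. \<exists>a\<in>A. v a \<noteq> 0}"

text \<open>The point \<open>[v a | a \<in> A]\<close>, as the class of all nonzero multiples of \<open>v\<close>.\<close>

definition proj_point :: "'a set \<Rightarrow> ('a \<Rightarrow> real) \<Rightarrow> ('a \<Rightarrow> real) set" where
  "proj_point A v = {\<lambda>a\<in>A. c * v a | c. c \<noteq> 0}"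

definition RP :: "'a set \<Rightarrow> ('a \<Rightarrow> real) set set" where
  "RP A = proj_point A ` nonzero_coords A"

text \<open>The quotient topology.\<close>

definition RP_topology :: "'a set \<Rightarrow> ('a \<Rightarrow> real) set topology" where
  "RP_topology A = topology (\<lambda>S. S \<subseteq> RP A \<and>
     openin (subtopology (powertop_real A) (nonzero_coords A))
       {v \<in> nonzero_coords A. proj_point A v \<in> S})"

lemma openin_RP_topology:
  "openin (RP_topology A) S \<longleftrightarrow> S \<subseteq> RP A \<and>
     openin (subtopology (powertop_real A) (nonzero_coords A))
       {v \<in> nonzero_coords A. proj_point A v \<in> S}"
proof -
  let ?T = "subtopology (powertop_real A) (nonzero_coords A)"
  let ?pre = "\<lambda>S. {v \<in> nonzero_coords A. proj_point A v \<in> S}"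
  have "istopology (\<lambda>S. S \<subseteq> RP A \<and> openin ?T (?pre S))"
    unfolding istopology_def
  proof (intro conjI allI impI)
    fix S S' assume *: "S \<subseteq> RP A \<and> openin ?T (?pre S)" "S' \<subseteq> RP A \<and> openin ?T (?pre S')"
    then show "S \<inter> S' \<subseteq> RP A" by blast
    have "?pre (S \<inter> S') = ?pre S \<inter> ?pre S'" by blast
    then show "openin ?T (?pre (S \<inter> S'))" using * by (simp add: openin_Int)
  next
    fix K assume *: "\<forall>S\<in>K. S \<subseteq> RP A \<and> openin ?T (?pre S)"
    then show "\<Union>K \<subseteq> RP A" by blast
    have "?pre (\<Union>K) = (\<Union>S\<in>K. ?pre S)" by blast
    then show "openin ?T (?pre (\<Union>K))" using * by auto
  qed
  then show ?thesis by (simp add: RP_topology_def)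
qed

lemma topspace_RP_topology: "topspace (RP_topology A) = RP A"
proof
  show "topspace (RP_topology A) \<subseteq> RP A"
    using openin_RP_topology openin_topspace by blast
  have sub: "nonzero_coords A \<subseteq> topspace (powertop_real A)"
    by (auto simp: nonzero_coords_def)
  have "{v \<in> nonzero_coords A. proj_point A v \<in> RP A} = nonzero_coords A"
    by (auto simp: RP_def)
  then have "openin (RP_topology A) (RP A)"
    unfolding openin_RP_topology
    using sub by (metis openin_subtopology_refl order_refl)
  then show "RP A \<subseteq> topspace (RP_topology A)" by (rule openin_subset)
qed

definition X_variety :: "(int ^ 'n) set \<Rightarrow> (int ^ 'n \<Rightarrow> real) \<Rightarrow> (int ^ 'n \<Rightarrow> real) set set" where
  "X_variety A w =
     RP_topology A closure_of
       {proj_point A (\<lambda>a. w a * laurent_monomial x a) | x :: real ^ 'n. \<forall>i. 0 < x $ i}"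


section \<open>Patches\<close>

fun Ck_on :: "nat \<Rightarrow> 'v::real_normed_vector set \<Rightarrow> ('v \<Rightarrow> real) \<Rightarrow> bool" where
  "Ck_on 0 S f \<longleftrightarrow> continuous_on S f"
| "Ck_on (Suc k) S f \<longleftrightarrow>
     f differentiable_on S \<and> (\<forall>v. Ck_on k S (\<lambda>x. frechet_derivative f (at x) v))"

definition smooth_on :: "'v::real_normed_vector set \<Rightarrow> ('v \<Rightarrow> real) \<Rightarrow> bool" where
  "smooth_on S f \<longleftrightarrow> (\<forall>k. Ck_on k S f)"

text \<open>
  A patch is given by \<open>\<beta> a x\<close> for \<open>a \<in> A\<close> and \<open>x \<in> Delta A\<close>; other values are irrelevant.
  On the boundary of the polytope blending functions are only required to be continuous, so that a reparametrization with linear precision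
  whose blending functions are not differentiable at a vertex is not excluded.
\<close>

definition patch :: "(int ^ 'n) set \<Rightarrow> (int ^ 'n \<Rightarrow> real ^ 'n \<Rightarrow> real) \<Rightarrow> bool" where
  "patch A \<beta> \<longleftrightarrow>
     (\<forall>a\<in>A. \<forall>x\<in>Delta A. 0 \<le> \<beta> a x) \<and>
     (\<forall>a\<in>A. continuous_on (Delta A) (\<beta> a) \<and> smooth_on (interior (Delta A)) (\<beta> a)) \<and>
     (\<forall>x\<in>Delta A. \<exists>a\<in>A. \<beta> a x \<noteq> 0)"

definition normalized ::
  "(int ^ 'n) set \<Rightarrow> (int ^ 'n \<Rightarrow> real ^ 'n \<Rightarrow> real) \<Rightarrow> int ^ 'n \<Rightarrow> real ^ 'n \<Rightarrow> real" where
  "normalized A \<beta> a x = \<beta> a x / (\<Sum>b\<in>A. \<beta> b x)"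

definition tautological_map ::
  "(int ^ 'n) set \<Rightarrow> (int ^ 'n \<Rightarrow> real ^ 'n \<Rightarrow> real) \<Rightarrow> real ^ 'n \<Rightarrow> real ^ 'n" where
  "tautological_map A \<beta> x = (\<Sum>a\<in>A. normalized A \<beta> a x *\<^sub>R real_vec a)"

definition proper_patch :: "(int ^ 'n) set \<Rightarrow> (int ^ 'n \<Rightarrow> real ^ 'n \<Rightarrow> real) \<Rightarrow> bool" where
  "proper_patch A \<beta> \<longleftrightarrow>
     (\<exists>g. homeomorphism (Delta A) (Delta A) (tautological_map A \<beta>) g)"

text \<open>Affine functions are written as \<open>\<lambda>x. L x + c\<close> with \<open>L\<close> linear.\<close>

definition linear_precision ::
  "(int ^ 'n) set \<Rightarrow> (int ^ 'n \<Rightarrow> real ^ 'n \<Rightarrow> real) \<Rightarrow> bool" where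
  "linear_precision A \<beta> \<longleftrightarrow>
     (\<forall>(L :: real ^ 'n \<Rightarrow> real) c. linear L \<longrightarrow>
        (\<forall>x\<in>Delta A. L x + c = (\<Sum>a\<in>A. normalized A \<beta> a x * (L (real_vec a) + c))))"

definition reparametrize ::
  "(int ^ 'n \<Rightarrow> real ^ 'n \<Rightarrow> real) \<Rightarrow> (real ^ 'n \<Rightarrow> real ^ 'n) \<Rightarrow> int ^ 'n \<Rightarrow> real ^ 'n \<Rightarrow> real" where
  "reparametrize \<beta> \<psi> a = \<beta> a \<circ> \<psi>"

text \<open>
  The denominator may vanish at some points of \<open>S\<close>: for instance blending functions such as
  \<open>x * y / (1 - z)\<close> on a square pyramid extend continuously to the apex, where the quotient is
  undefined. The sets \<open>S\<close> considered are closures of their nonempty interiors, so a nonzero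
  denominator is nonzero on a dense subset of \<open>S\<close>.
\<close>

definition rational_function_on :: "(real ^ 'n) set \<Rightarrow> (real ^ 'n \<Rightarrow> real) \<Rightarrow> bool" where
  "rational_function_on S g \<longleftrightarrow>
     (\<exists>p q. polynomial_fun p \<and> polynomial_fun q \<and> (\<exists>x. q x \<noteq> 0) \<and>
        (\<forall>x\<in>S. q x \<noteq> 0 \<longrightarrow> g x = p x / q x))"

text \<open>
  A patch with linear precision is understood to be normalized, so it is the normalized blending
  functions of the reparametrization that have to be rational. The homeomorphism \<open>\<psi>\<close> is
  determined on the polytope: it is the inverse of the tautological map.
\<close>

definition rational_linear_precision ::
  "(int ^ 'n) set \<Rightarrow> (int ^ 'n \<Rightarrow> real ^ 'n \<Rightarrow> real) \<Rightarrow> bool" where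
  "rational_linear_precision A \<beta> \<longleftrightarrow>
     proper_patch A \<beta> \<and>
     (\<exists>\<psi> \<psi>'. homeomorphism (Delta A) (Delta A) \<psi> \<psi>' \<and>
        linear_precision A (reparametrize \<beta> \<psi>) \<and>
        (\<forall>a\<in>A. rational_function_on (Delta A) (normalized A (reparametrize \<beta> \<psi>) a)))"

definition toric_patch ::
  "(int ^ 'n) set \<Rightarrow> (int ^ 'n \<Rightarrow> real) \<Rightarrow> (int ^ 'n \<Rightarrow> real ^ 'n \<Rightarrow> real) \<Rightarrow> bool" where
  "toric_patch A w \<beta> \<longleftrightarrow>
     patch A \<beta> \<and> (\<lambda>x. proj_point A (\<lambda>a. \<beta> a x)) ` Delta A = X_variety A w"

end

theory Submission
  imports Defs
begin

text \<open>
  Let \<open>\<tau>\<close> be the tautological map. Since the patch is toric, every \<open>[w\<^sub>a x\<^sup>a]\<close> with \<open>x > 0\<close> is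
  attained by the patch, so on the positive orthant \<open>\<psi>(x) = \<Sum>\<^sub>a (w\<^sub>a x\<^sup>a / f(x)) a\<close> is \<open>\<tau>\<close> at some
  point, and \<open>\<gamma>\<^sub>a(\<psi>(x)) = w\<^sub>a x\<^sup>a / f(x)\<close> for the blending functions \<open>\<gamma>\<^sub>a\<close> of the reparametrization
  by \<open>\<tau>\<^sup>-\<^sup>1\<close>. Properness and primitivity make \<open>\<psi>\<close> injective on the orthant, so its image \<open>O\<close> is
  open by invariance of domain; and \<open>O\<close> is dense in the polytope because \<open>X\<close> is the closure of
  the torus orbit. If the \<open>\<gamma>\<^sub>a\<close> are rational, write \<open>e\<^sub>i = \<Sum>\<^sub>a c\<^sub>i\<^sub>a a\<close> with \<open>\<Sum>\<^sub>a c\<^sub>i\<^sub>a = 0\<close>; the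
  factor \<open>f\<close> then cancels in \<open>\<Prod>\<^sub>a (\<gamma>\<^sub>a / w\<^sub>a)^c\<^sub>i\<^sub>a\<close>, which recovers \<open>x\<^sub>i\<close> on \<open>O\<close> and hence
  everywhere by Zariski density of nonempty open sets of real points. Conversely, if \<open>G\<close> inverts
  \<open>\<psi>\<close>, then \<open>\<gamma>\<^sub>a = w\<^sub>a G\<^sup>a / f(G)\<close> on a dense subset of \<open>O\<close>, and by continuity on the polytope.
\<close>

section \<open>Polynomial functions\<close>

lemma polynomial_fun_monomial: "polynomial_fun (\<lambda>x. c * (\<Prod>i\<in>UNIV. x $ i ^ m $ i))"
  unfolding polynomial_fun_def by (rule exI[of _ "{m}"], rule exI[of _ "\<lambda>_. c"]) simp

lemma polynomial_fun_const: "polynomial_fun (\<lambda>x. c)"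
  using polynomial_fun_monomial[of c 0] by simp

lemma polynomial_fun_component: "polynomial_fun (\<lambda>x :: 'k::field ^ 'n. x $ i)"
proof -
  have "(\<Prod>j\<in>UNIV. x $ j ^ axis i (1::nat) $ j) = x $ i" for x :: "'k ^ 'n"
  proof -
    have "(\<Prod>j\<in>UNIV. x $ j ^ axis i (1::nat) $ j) = (\<Prod>j\<in>UNIV. if j = i then x $ j else 1)"
      by (rule prod.cong) (auto simp: axis_def)
    then show ?thesis by simp
  qed
  moreover have "polynomial_fun (\<lambda>x :: 'k ^ 'n. 1 * (\<Prod>j\<in>UNIV. x $ j ^ axis i (1::nat) $ j))"
    by (rule polynomial_fun_monomial)
  ultimately show ?thesis by (simp only: mult_1_left)
qed

lemma polynomial_fun_add:
  assumes "polynomial_fun p" "polynomial_fun q"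
  shows "polynomial_fun (\<lambda>x. p x + q x)"
proof -
  obtain M c where M: "finite M" "p = (\<lambda>x. \<Sum>m\<in>M. c m * (\<Prod>i\<in>UNIV. x $ i ^ m $ i))"
    using assms(1) unfolding polynomial_fun_def by blast
  obtain N d where N: "finite N" "q = (\<lambda>x. \<Sum>m\<in>N. d m * (\<Prod>i\<in>UNIV. x $ i ^ m $ i))"
    using assms(2) unfolding polynomial_fun_def by blast
  let ?e = "\<lambda>m. (if m \<in> M then c m else 0) + (if m \<in> N then d m else 0)"
  have "p x + q x = (\<Sum>m\<in>M \<union> N. ?e m * (\<Prod>i\<in>UNIV. x $ i ^ m $ i))" for x
  proof -
    have "p x = (\<Sum>m\<in>M \<union> N. (if m \<in> M then c m else 0) * (\<Prod>i\<in>UNIV. x $ i ^ m $ i))"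
      unfolding M(2) using M(1) N(1) by (intro sum.mono_neutral_cong_left) auto
    moreover have "q x = (\<Sum>m\<in>M \<union> N. (if m \<in> N then d m else 0) * (\<Prod>i\<in>UNIV. x $ i ^ m $ i))"
      unfolding N(2) using M(1) N(1) by (intro sum.mono_neutral_cong_left) auto
    ultimately show ?thesis by (simp only: sum.distrib distrib_right)
  qed
  then show ?thesis
    unfolding polynomial_fun_def using M(1) N(1)
    by (intro exI[of _ "M \<union> N"] exI[of _ ?e]) auto
qed

lemma polynomial_fun_sum:
  assumes "\<And>i. i \<in> I \<Longrightarrow> polynomial_fun (p i)"
  shows "polynomial_fun (\<lambda>x. \<Sum>i\<in>I. p i x)"
  using assms
  by (induction I rule: infinite_finite_induct) (auto intro: polynomial_fun_const polynomial_fun_add)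

lemma polynomial_fun_mult:
  assumes "polynomial_fun p" "polynomial_fun q"
  shows "polynomial_fun (\<lambda>x. p x * q x)"
proof -
  obtain M c where M: "finite M" "p = (\<lambda>x. \<Sum>m\<in>M. c m * (\<Prod>i\<in>UNIV. x $ i ^ m $ i))"
    using assms(1) unfolding polynomial_fun_def by blast
  obtain N d where N: "finite N" "q = (\<lambda>x. \<Sum>m\<in>N. d m * (\<Prod>i\<in>UNIV. x $ i ^ m $ i))"
    using assms(2) unfolding polynomial_fun_def by blast
  have "p x * q x = (\<Sum>m\<in>M. \<Sum>n\<in>N. (c m * d n) * (\<Prod>i\<in>UNIV. x $ i ^ (m + n) $ i))" for x
    unfolding M(2) N(2) sum_product
    by (intro sum.cong refl) (simp add: power_add prod.distrib mult_ac)
  then have "(\<lambda>x. p x * q x) =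
      (\<lambda>x. \<Sum>m\<in>M. \<Sum>n\<in>N. (c m * d n) * (\<Prod>i\<in>UNIV. x $ i ^ (m + n) $ i))"
    by (rule ext)
  then show ?thesis
    by (simp only: polynomial_fun_sum polynomial_fun_monomial)
qed

lemma polynomial_fun_diff:
  assumes "polynomial_fun p" "polynomial_fun q"
  shows "polynomial_fun (\<lambda>x. p x - q x)"
  using polynomial_fun_add[OF assms(1) polynomial_fun_mult[OF polynomial_fun_const[of "- 1"] assms(2)]]
  by simp

lemma polynomial_fun_prod:
  assumes "\<And>i. i \<in> I \<Longrightarrow> polynomial_fun (p i)"
  shows "polynomial_fun (\<lambda>x. \<Prod>i\<in>I. p i x)"
  using assms
  by (induction I rule: infinite_finite_induct) (auto intro: polynomial_fun_const polynomial_fun_mult)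

lemma continuous_on_polynomial_fun:
  fixes p :: "'k::{real_normed_field} ^ 'n \<Rightarrow> 'k"
  assumes "polynomial_fun p"
  shows "continuous_on S p"
  using assms unfolding polynomial_fun_def by (auto intro!: continuous_intros)

text \<open>Each coordinate of \<open>u + t *s v\<close> is linear in \<open>t\<close>, so
  substitution yields a univariate polynomial. Vanishing of multivariate polynomials is thereby
  reduced to counting roots.\<close>

lemma polynomial_fun_line:
  assumes "polynomial_fun p"
  obtains P where "\<And>t. p (u + t *s v) = poly P t"
proof -
  obtain M c where M: "p = (\<lambda>x. \<Sum>m\<in>M. c m * (\<Prod>i\<in>UNIV. x $ i ^ m $ i))"
    using assms unfolding polynomial_fun_def by blast
  show thesis
    by (rule that[of "\<Sum>m\<in>M. smult (c m) (\<Prod>i\<in>UNIV. [:u $ i, v $ i:] ^ (m $ i))"])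
      (simp add: M poly_sum poly_prod)
qed

section \<open>Real points inside complex space and their Zariski density\<close>

definition complex_vec :: "real ^ 'n \<Rightarrow> complex ^ 'n" where
  "complex_vec y = (\<chi> i. of_real (y $ i))"

lemma complex_vec_nth [simp]: "complex_vec y $ i = of_real (y $ i)"
  by (simp add: complex_vec_def)

lemma continuous_on_complex_vec: "continuous_on S complex_vec"
  unfolding complex_vec_def by (intro continuous_intros)

lemma poly_eq_0_if_zero_on_open_reals:
  fixes P :: "complex poly"
  assumes "open T" "T \<noteq> {}" "\<And>t. t \<in> T \<Longrightarrow> poly P (of_real t) = 0"
  shows "P = 0"
proof (rule ccontr)
  assume "P \<noteq> 0"
  then have "finite {z. poly P z = 0}" by (rule poly_roots_finite)
  moreover have "complex_of_real ` T \<subseteq> {z. poly P z = 0}" using assms(3) by auto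
  ultimately have "finite (complex_of_real ` T)" by (rule rev_finite_subset)
  then have "finite T" by (rule finite_imageD) (auto simp: inj_on_def)
  then show False using assms(1,2) not_open_singleton finite_imp_not_open by blast
qed

text \<open>A line through a point of the open set gives vanishing at all real points; the complex
  point \<open>u + \<i> v\<close> then lies on the complexification of the real line \<open>u + t v\<close>.\<close>

lemma polynomial_fun_zero_if_zero_on_open_reals:
  fixes p :: "complex ^ 'n \<Rightarrow> complex"
  assumes p: "polynomial_fun p" and S: "open S" "S \<noteq> {}"
    and zero: "\<And>y. y \<in> S \<Longrightarrow> p (complex_vec y) = 0"
  shows "p z = 0"
proof -
  obtain y0 where y0: "y0 \<in> S" using S(2) by blast
  have real: "p (complex_vec y) = 0" for y
  proof -
    obtain P where P: "\<And>t. p (complex_vec y0 + t *s complex_vec (y - y0)) = poly P t"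
      using polynomial_fun_line[OF p] by blast
    define T where "T = (\<lambda>t. y0 + t *\<^sub>R (y - y0)) -` S"
    have "open T" unfolding T_def
      by (rule open_vimage[OF S(1)]) (intro continuous_intros)
    moreover have "T \<noteq> {}" 
    proof -
      have "0 \<in> T" using y0 by (simp add: T_def)
      then show ?thesis by blast
    qed
    moreover have "poly P (of_real t) = 0" if "t \<in> T" for t
    proof -
      have "complex_vec y0 + of_real t *s complex_vec (y - y0) = complex_vec (y0 + t *\<^sub>R (y - y0))"
        by (simp add: vec_eq_iff)
      then show ?thesis using zero that P[of "of_real t"] by (auto simp: T_def)
    qed
    ultimately have "P = 0" by (rule poly_eq_0_if_zero_on_open_reals)
    moreover have "complex_vec y0 + 1 *s complex_vec (y - y0) = complex_vec y"
      by (simp add: vec_eq_iff)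
    ultimately show ?thesis using P[of 1] by simp
  qed
  define u v where "u = (\<chi> i. Re (z $ i))" and "v = (\<chi> i. Im (z $ i))"
  obtain P where P: "\<And>t. p (complex_vec u + t *s complex_vec v) = poly P t"
    using polynomial_fun_line[OF p] by blast
  have "poly P (of_real t) = 0" for t
  proof -
    have "complex_vec u + of_real t *s complex_vec v = complex_vec (u + t *\<^sub>R v)"
      by (simp add: vec_eq_iff)
    then show ?thesis using real P[of "of_real t"] by simp
  qed
  then have "P = 0" using poly_eq_0_if_zero_on_open_reals[of UNIV P] by simp
  moreover have "complex_vec u + \<i> *s complex_vec v = z"
    by (simp add: vec_eq_iff u_def v_def complex_eq_iff)
  ultimately show ?thesis using P[of \<i>] by simp
qed

text \<open>The same coefficients are read as complex numbers. This carries the real fractions for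
  the blending functions into the complex setting of \<open>psi_map\<close>.\<close>

lemma complexify_polynomial_fun:
  assumes "polynomial_fun (p :: real ^ 'n \<Rightarrow> real)"
  obtains P where "polynomial_fun P" "\<And>y. P (complex_vec y) = of_real (p y)"
proof -
  obtain M c where M: "finite M" "p = (\<lambda>x. \<Sum>m\<in>M. c m * (\<Prod>i\<in>UNIV. x $ i ^ m $ i))"
    using assms unfolding polynomial_fun_def by blast
  show thesis
    by (rule that[of "\<lambda>x. \<Sum>m\<in>M. of_real (c m) * (\<Prod>i\<in>UNIV. x $ i ^ m $ i)"])
      (auto simp: M intro!: polynomial_fun_sum polynomial_fun_monomial)
qed

text \<open>Monomials are real at real points, so real and imaginary parts act on the coefficients
  alone. This is the way back from complex fractions to real ones.\<close>

lemma polynomial_fun_Re_Im: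
  fixes P :: "complex ^ 'n \<Rightarrow> complex"
  assumes "polynomial_fun P"
  shows "polynomial_fun (\<lambda>y. Re (P (complex_vec y)))" "polynomial_fun (\<lambda>y. Im (P (complex_vec y)))"
proof -
  obtain M c where M: "finite M" "P = (\<lambda>x. \<Sum>m\<in>M. c m * (\<Prod>i\<in>UNIV. x $ i ^ m $ i))"
    using assms unfolding polynomial_fun_def by blast
  have *: "(\<Prod>i\<in>UNIV. complex_vec y $ i ^ m $ i) = of_real (\<Prod>i\<in>UNIV. y $ i ^ m $ i)"
    for y :: "real ^ 'n" and m :: "nat ^ 'n" by simp
  have **: "Re (z * of_real r) = Re z * r" "Im (z * of_real r) = Im z * r" for z r by simp_all
  have "Re (P (complex_vec y)) = (\<Sum>m\<in>M. Re (c m) * (\<Prod>i\<in>UNIV. y $ i ^ m $ i))"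
    "Im (P (complex_vec y)) = (\<Sum>m\<in>M. Im (c m) * (\<Prod>i\<in>UNIV. y $ i ^ m $ i))" for y
    unfolding M(2) * Re_sum Im_sum ** by (rule refl)+
  then show "polynomial_fun (\<lambda>y. Re (P (complex_vec y)))" "polynomial_fun (\<lambda>y. Im (P (complex_vec y)))"
    by (auto intro!: polynomial_fun_sum polynomial_fun_monomial)
qed


section \<open>Regular functions on principal open sets\<close>

text \<open>One coordinate of a \<open>rational_map\<close>, isolated so that arithmetic and
  composition can be treated function by function. A single fraction has to serve on all of
  \<open>U\<close>.\<close>

definition regular_on :: "('k::field ^ 'n) set \<Rightarrow> ('k ^ 'n \<Rightarrow> 'k) \<Rightarrow> bool" where
  "regular_on U f \<longleftrightarrow>
     (\<exists>p q. polynomial_fun p \<and> polynomial_fun q \<and> (\<forall>x\<in>U. q x \<noteq> 0 \<and> f x = p x / q x))"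

definition principal_open :: "('k::field ^ 'n) set \<Rightarrow> bool" where
  "principal_open U \<longleftrightarrow> (\<exists>g. polynomial_fun g \<and> U = {x. g x \<noteq> 0})"

lemma rational_map_iff:
  "rational_map U F \<longleftrightarrow> U \<noteq> {} \<and> principal_open U \<and> (\<forall>i. regular_on U (\<lambda>x. F x $ i))"
  by (simp add: rational_map_def principal_open_def regular_on_def)

lemma regular_on_polynomial_fun: "polynomial_fun p \<Longrightarrow> regular_on U p"
  unfolding regular_on_def using polynomial_fun_const[of 1] by (intro exI[of _ p] exI[of _ "\<lambda>_. 1"]) auto

lemma regular_on_const: "regular_on U (\<lambda>x. c)"
  by (intro regular_on_polynomial_fun polynomial_fun_const)

lemma regular_on_component: "regular_on U (\<lambda>x. x $ i)"
  by (intro regular_on_polynomial_fun polynomial_fun_component)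

lemma regular_on_subset: "regular_on U f \<Longrightarrow> V \<subseteq> U \<Longrightarrow> regular_on V f"
  unfolding regular_on_def by blast

lemma regular_on_cong: "regular_on U f \<Longrightarrow> (\<And>x. x \<in> U \<Longrightarrow> g x = f x) \<Longrightarrow> regular_on U g"
  unfolding regular_on_def by metis

lemma regular_on_add:
  assumes "regular_on U f" "regular_on U g"
  shows "regular_on U (\<lambda>x. f x + g x)"
proof -
  obtain p q where f: "polynomial_fun p" "polynomial_fun q" "\<forall>x\<in>U. q x \<noteq> 0 \<and> f x = p x / q x"
    using assms(1) unfolding regular_on_def by blast
  obtain r s where g: "polynomial_fun r" "polynomial_fun s" "\<forall>x\<in>U. s x \<noteq> 0 \<and> g x = r x / s x"
    using assms(2) unfolding regular_on_def by blast
  show ?thesis unfolding regular_on_def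
    using f g
    by (intro exI[of _ "\<lambda>x. p x * s x + r x * q x"] exI[of _ "\<lambda>x. q x * s x"])
      (auto intro!: polynomial_fun_mult polynomial_fun_add simp: add_frac_eq)
qed

lemma regular_on_mult:
  assumes "regular_on U f" "regular_on U g"
  shows "regular_on U (\<lambda>x. f x * g x)"
proof -
  obtain p q where f: "polynomial_fun p" "polynomial_fun q" "\<forall>x\<in>U. q x \<noteq> 0 \<and> f x = p x / q x"
    using assms(1) unfolding regular_on_def by blast
  obtain r s where g: "polynomial_fun r" "polynomial_fun s" "\<forall>x\<in>U. s x \<noteq> 0 \<and> g x = r x / s x"
    using assms(2) unfolding regular_on_def by blast
  show ?thesis unfolding regular_on_def
    using f g
    by (intro exI[of _ "\<lambda>x. p x * r x"] exI[of _ "\<lambda>x. q x * s x"])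
      (auto intro!: polynomial_fun_mult)
qed

lemma regular_on_inverse:
  assumes "regular_on U f" "\<And>x. x \<in> U \<Longrightarrow> f x \<noteq> 0"
  shows "regular_on U (\<lambda>x. inverse (f x))"
proof -
  obtain p q where f: "polynomial_fun p" "polynomial_fun q" "\<forall>x\<in>U. q x \<noteq> 0 \<and> f x = p x / q x"
    using assms(1) unfolding regular_on_def by blast
  then show ?thesis unfolding regular_on_def
    using assms(2) by (intro exI[of _ q] exI[of _ p]) auto
qed

lemma regular_on_divide:
  assumes "regular_on U f" "regular_on U g" "\<And>x. x \<in> U \<Longrightarrow> g x \<noteq> 0"
  shows "regular_on U (\<lambda>x. f x / g x)"
  using regular_on_mult[OF assms(1) regular_on_inverse[OF assms(2,3)]] by (simp add: field_simps)

lemma regular_on_sum: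
  assumes "\<And>i. i \<in> I \<Longrightarrow> regular_on U (f i)"
  shows "regular_on U (\<lambda>x. \<Sum>i\<in>I. f i x)"
  using assms
  by (induction I rule: infinite_finite_induct) (auto intro: regular_on_const regular_on_add)

lemma regular_on_prod:
  assumes "\<And>i. i \<in> I \<Longrightarrow> regular_on U (f i)"
  shows "regular_on U (\<lambda>x. \<Prod>i\<in>I. f i x)"
  using assms
  by (induction I rule: infinite_finite_induct) (auto intro: regular_on_const regular_on_mult)

lemma regular_on_power:
  assumes "regular_on U f"
  shows "regular_on U (\<lambda>x. f x ^ n)"
  by (induction n) (auto intro: regular_on_const regular_on_mult assms)

lemma regular_on_power_int:
  assumes "regular_on U f" "\<And>x. x \<in> U \<Longrightarrow> f x \<noteq> 0"
  shows "regular_on U (\<lambda>x. f x powi k)"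
  using assms by (cases "k \<ge> 0") (auto simp: power_int_def intro!: regular_on_power regular_on_inverse)

lemma regular_on_polynomial_compose:
  assumes "polynomial_fun p" "\<And>i. regular_on U (\<lambda>x. F x $ i)"
  shows "regular_on U (\<lambda>x. p (F x))"
proof -
  obtain M c where M: "p = (\<lambda>x. \<Sum>m\<in>M. c m * (\<Prod>i\<in>UNIV. x $ i ^ m $ i))"
    using assms(1) unfolding polynomial_fun_def by blast
  show ?thesis unfolding M
    by (intro regular_on_sum regular_on_mult regular_on_const regular_on_prod regular_on_power assms)
qed

lemma regular_on_compose:
  assumes "regular_on V g" "\<And>i. regular_on U (\<lambda>x. F x $ i)" "F ` U \<subseteq> V"
  shows "regular_on U (\<lambda>x. g (F x))"
proof -
  obtain p q where g: "polynomial_fun p" "polynomial_fun q" "\<forall>x\<in>V. q x \<noteq> 0 \<and> g x = p x / q x"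
    using assms(1) unfolding regular_on_def by blast
  have "regular_on U (\<lambda>x. p (F x) / q (F x))"
    using g(3) assms(3)
    by (intro regular_on_divide regular_on_polynomial_compose[OF g(1) assms(2)]
        regular_on_polynomial_compose[OF g(2) assms(2)]) auto
  then show ?thesis by (rule regular_on_cong) (use g assms(3) in auto)
qed

text \<open>On \<open>U\<close> the zeros of \<open>f\<close> are those of its numerator, so the
  product of that numerator with the polynomial defining \<open>U\<close> cuts out the set.\<close>

lemma principal_open_nonzero:
  assumes "principal_open U" "regular_on U f"
  shows "principal_open {x \<in> U. f x \<noteq> 0}"
proof -
  obtain g where g: "polynomial_fun g" "U = {x. g x \<noteq> 0}"
    using assms(1) unfolding principal_open_def by blast
  obtain p q where f: "polynomial_fun p" "polynomial_fun q" "\<forall>x\<in>U. q x \<noteq> 0 \<and> f x = p x / q x"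
    using assms(2) unfolding regular_on_def by blast
  have "{x \<in> U. f x \<noteq> 0} = {x. g x * p x \<noteq> 0}" using g(2) f(3) by auto
  then show ?thesis
    unfolding principal_open_def using polynomial_fun_mult[OF g(1) f(1)] by blast
qed

text \<open>Domains of composites of rational maps have this form; a polynomial defining
  \<open>V\<close> becomes a regular function on \<open>U\<close> when composed with
  \<open>F\<close>.\<close>

lemma principal_open_preimage:
  assumes "principal_open U" "\<And>i. regular_on U (\<lambda>x. F x $ i)" "principal_open V"
  shows "principal_open {x \<in> U. F x \<in> V}"
proof -
  obtain h where h: "polynomial_fun h" "V = {x. h x \<noteq> 0}"
    using assms(3) unfolding principal_open_def by blast
  show ?thesis
    using principal_open_nonzero[OF assms(1) regular_on_polynomial_compose[OF h(1) assms(2)]]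
    by (simp add: h(2))
qed

lemma principal_open_meets_open_reals:
  fixes U :: "(complex ^ 'n) set"
  assumes "principal_open U" "U \<noteq> {}" "open S" "S \<noteq> {}"
  shows "\<exists>y\<in>S. complex_vec y \<in> U"
proof -
  obtain g where g: "polynomial_fun g" "U = {x. g x \<noteq> 0}"
    using assms(1) unfolding principal_open_def by blast
  show ?thesis
    using polynomial_fun_zero_if_zero_on_open_reals[OF g(1) assms(3,4)] assms(2) g(2) by blast
qed

text \<open>Identity principle. Cross-multiplying the two fractions gives a polynomial; the extra
  factor \<open>h\<close>, which vanishes off \<open>U\<close>, makes the product zero at every real
  point of \<open>S\<close>, also where the fractions are undefined. At a point of \<open>U\<close>
  the factor \<open>h\<close> can be cancelled again.\<close>

lemma regular_on_eq_if_eq_on_open_reals: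
  fixes U :: "(complex ^ 'n) set"
  assumes U: "principal_open U" and fg: "regular_on U f" "regular_on U g"
    and S: "open S" "S \<noteq> {}"
    and eq: "\<And>y. y \<in> S \<Longrightarrow> complex_vec y \<in> U \<Longrightarrow> f (complex_vec y) = g (complex_vec y)"
    and x: "x \<in> U"
  shows "f x = g x"
proof -
  obtain h where h: "polynomial_fun h" "U = {x. h x \<noteq> 0}"
    using U unfolding principal_open_def by blast
  obtain p q where f: "polynomial_fun p" "polynomial_fun q" "\<forall>x\<in>U. q x \<noteq> 0 \<and> f x = p x / q x"
    using fg(1) unfolding regular_on_def by blast
  obtain r s where g: "polynomial_fun r" "polynomial_fun s" "\<forall>x\<in>U. s x \<noteq> 0 \<and> g x = r x / s x"
    using fg(2) unfolding regular_on_def by blast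
  let ?P = "\<lambda>x. h x * (p x * s x - r x * q x)"
  have iff: "f x = g x \<longleftrightarrow> p x * s x - r x * q x = 0" if "x \<in> U" for x
    using f(3) g(3) that by (auto simp: frac_eq_eq)
  have "polynomial_fun ?P"
    by (intro polynomial_fun_mult polynomial_fun_diff h f g)
  moreover have "?P (complex_vec y) = 0" if "y \<in> S" for y
  proof (cases "complex_vec y \<in> U")
    case True
    then show ?thesis using eq[OF that True] iff by simp
  next
    case False
    then show ?thesis using h(2) by simp
  qed
  ultimately have "?P x = 0" using polynomial_fun_zero_if_zero_on_open_reals[OF _ S, of ?P x] by blast
  then show ?thesis using x h(2) iff[OF x] by simp
qed


section \<open>Laurent monomials\<close>

lemma prod_power_int: "(\<Prod>i\<in>I. f i) powi k = (\<Prod>i\<in>I. (f i :: 'k::field) powi k)"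
  by (induction I rule: infinite_finite_induct) (auto simp: power_int_mult_distrib)

lemma power_int_sum: "z \<noteq> 0 \<Longrightarrow> z powi (\<Sum>i\<in>I. k i) = (\<Prod>i\<in>I. (z :: 'k::field) powi k i)"
  by (induction I rule: infinite_finite_induct) (auto simp: power_int_add)

lemma laurent_monomial_pos:
  "(\<And>i. 0 < x $ i) \<Longrightarrow> 0 < laurent_monomial (x :: real ^ 'n) a"
  unfolding laurent_monomial_def by (intro prod_pos zero_less_power_int) auto

lemma laurent_monomial_complex_vec:
  "laurent_monomial (complex_vec x) a = of_real (laurent_monomial x a)"
  by (simp add: laurent_monomial_def)

lemma regular_on_laurent_monomial:
  assumes "\<And>i. regular_on U (\<lambda>x. F x $ i)" "\<And>x i. x \<in> U \<Longrightarrow> F x $ i \<noteq> 0"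
  shows "regular_on U (\<lambda>x. laurent_monomial (F x) a)"
  unfolding laurent_monomial_def by (intro regular_on_prod regular_on_power_int assms)

lemma regular_on_laurent_poly:
  assumes "\<And>i. regular_on U (\<lambda>x. F x $ i)" "\<And>x i. x \<in> U \<Longrightarrow> F x $ i \<noteq> 0"
  shows "regular_on U (\<lambda>x. laurent_poly A w (F x))"
  unfolding laurent_poly_def
  by (intro regular_on_sum regular_on_mult regular_on_const regular_on_laurent_monomial assms)

text \<open>The exponents \<open>c a\<close> sum to zero, so the common denominator \<open>r\<close>
  cancels; their weighted sum of exponent vectors is the \<open>i\<close>-th unit vector, so only
  \<open>x $ i\<close> survives. With \<open>r\<close> the value of the Laurent polynomial, this
  recovers a torus point from its toric coordinates.\<close>

lemma prod_laurent_monomial_power_int: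
  fixes x :: "'k::field ^ 'n"
  assumes nz: "\<And>i. x $ i \<noteq> 0" "r \<noteq> 0"
    and c: "(\<Sum>a\<in>A. c a) = 0" "\<And>j. (\<Sum>a\<in>A. c a * a $ j) = (if j = i then 1 else 0)"
  shows "(\<Prod>a\<in>A. (laurent_monomial x a / r) powi c a) = x $ i"
proof -
  have "(\<Prod>a\<in>A. (laurent_monomial x a / r) powi c a)
      = (\<Prod>a\<in>A. \<Prod>j\<in>UNIV. x $ j powi (a $ j * c a)) / (\<Prod>a\<in>A. r powi c a)"
    unfolding prod_dividef[symmetric]
    by (intro prod.cong refl)
      (simp add: power_int_divide_distrib laurent_monomial_def prod_power_int
        power_int_mult)
  also have "(\<Prod>a\<in>A. \<Prod>j\<in>UNIV. x $ j powi (a $ j * c a))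
      = (\<Prod>j\<in>UNIV. x $ j powi (\<Sum>a\<in>A. c a * a $ j))"
    by (subst prod.swap) (simp add: power_int_sum nz mult.commute)
  also have "\<dots> = (\<Prod>j\<in>UNIV. if j = i then x $ j else 1)"
    unfolding c(2) by (intro prod.cong) auto
  also have "\<dots> = x $ i" by simp
  also have "(\<Prod>a\<in>A. r powi c a) = 1"
    using power_int_sum[OF nz(2), of c A] c(1) by simp
  finally show ?thesis by simp
qed

text \<open>Subtracting an integer affine representation of the origin from one of the unit vector
  leaves coefficients with sum zero.\<close>

lemma primitive_axis:
  assumes "primitive A"
  obtains c where "(\<Sum>a\<in>A. c a) = 0" "\<And>j. (\<Sum>a\<in>A. c a * a $ j) = (if j = i then 1 else 0)"
proof -
  obtain c where c: "(\<Sum>a\<in>A. c a) = 1" "(\<Sum>a\<in>A. c a *s a) = axis i 1"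
    using assms unfolding primitive_def by blast
  obtain d where d: "(\<Sum>a\<in>A. d a) = 1" "(\<Sum>a\<in>A. d a *s a) = 0"
    using assms unfolding primitive_def by blast
  have "(\<Sum>a\<in>A. c a * a $ j) = axis i 1 $ j" "(\<Sum>a\<in>A. d a * a $ j) = 0" for j
    using arg_cong[OF c(2), of "\<lambda>v. v $ j"] arg_cong[OF d(2), of "\<lambda>v. v $ j"]
    by (simp_all add: sum_component)
  then show thesis using c(1) d(1)
    by (intro that[of "\<lambda>a. c a - d a"])
      (simp_all add: left_diff_distrib sum_subtractf axis_def)
qed

lemma primitive_nonempty: "primitive A \<Longrightarrow> A \<noteq> {}"
  unfolding primitive_def by fastforce

text \<open>The operator \<open>x $ i\<close> times the \<open>i\<close>-th partial derivative
  multiplies each monomial by \<open>a $ i\<close>. The factors \<open>?R a\<close> are constant in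
  the variable that is differentiated, so only an integer power of one nonzero variable
  remains.\<close>

lemma psi_map_nth:
  fixes x :: "complex ^ 'n"
  assumes "\<And>i. x $ i \<noteq> 0"
  shows "psi_map A w x $ i =
    (\<Sum>a\<in>A. of_real (w a) * of_int (a $ i) * laurent_monomial x a) / laurent_poly A w x"
proof -
  let ?R = "\<lambda>a. \<Prod>j\<in>UNIV - {i}. x $ j powi a $ j"
  have mono: "laurent_monomial (\<chi> j. if j = i then t else x $ j) a = t powi a $ i * ?R a" for t a
  proof -
    have "laurent_monomial (\<chi> j. if j = i then t else x $ j) a
        = t powi a $ i * (\<Prod>j\<in>UNIV - {i}. (if j = i then t else x $ j) powi a $ j)"
      unfolding laurent_monomial_def by (subst prod.remove[of _ i]) auto
    also have "(\<Prod>j\<in>UNIV - {i}. (if j = i then t else x $ j) powi a $ j) = ?R a"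
      by (intro prod.cong) auto
    finally show ?thesis .
  qed
  have "(\<chi> j. if j = i then x $ i else x $ j) = x" by (simp add: vec_eq_iff)
  then have mono': "laurent_monomial x a = x $ i powi a $ i * ?R a" for a
    using mono[of "x $ i" a] by simp
  have "((\<lambda>t. laurent_poly A w (\<chi> j. if j = i then t else x $ j)) has_field_derivative
      (\<Sum>a\<in>A. of_real (w a) * (of_int (a $ i) * x $ i powi (a $ i - 1) * 1 * ?R a))) (at (x $ i))"
    unfolding laurent_poly_def mono
    by (intro derivative_intros DERIV_sum DERIV_cmult DERIV_cmult_right) (use assms in auto)
  then have "x $ i * partial_deriv i (laurent_poly A w) x
      = (\<Sum>a\<in>A. x $ i * (of_real (w a) * (of_int (a $ i) * x $ i powi (a $ i - 1) * 1 * ?R a)))"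
    unfolding partial_deriv_def by (simp only: DERIV_imp_deriv sum_distrib_left)
  also have "\<dots> = (\<Sum>a\<in>A. of_real (w a) * of_int (a $ i) * laurent_monomial x a)"
    using assms[of i] by (intro sum.cong refl) (simp add: mono' power_int_diff)
  finally show ?thesis by (simp add: psi_map_def)
qed

text \<open>Negative exponents keep \<open>laurent_poly\<close> from being a polynomial, but it is
  regular on the torus, the complement of the zeros of the product of all coordinates.\<close>

lemma principal_open_psi_dom: "principal_open (psi_dom A w)"
proof -
  let ?T = "{x :: complex ^ 'n. \<forall>i. x $ i \<noteq> 0}"
  have "?T = {x. (\<Prod>i\<in>UNIV. x $ i) \<noteq> 0}" by auto
  then have "principal_open ?T"
    unfolding principal_open_def
    by (intro exI[of _ "\<lambda>x. \<Prod>i\<in>UNIV. x $ i"] conjI polynomial_fun_prod polynomial_fun_component)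
  moreover have "regular_on ?T (laurent_poly A w)"
    using regular_on_laurent_poly[of ?T "\<lambda>x. x"] regular_on_component by auto
  ultimately show ?thesis
    using principal_open_nonzero[of ?T "laurent_poly A w"] by (simp add: psi_dom_def)
qed

lemma regular_on_psi_map: "regular_on (psi_dom A w) (\<lambda>x. psi_map A w x $ i)"
proof -
  have "regular_on (psi_dom A w) (\<lambda>x.
      (\<Sum>a\<in>A. of_real (w a) * of_int (a $ i) * laurent_monomial x a) / laurent_poly A w x)"
    by (intro regular_on_divide regular_on_sum regular_on_mult regular_on_const
        regular_on_laurent_monomial[of _ "\<lambda>x. x"] regular_on_laurent_poly[of _ "\<lambda>x. x"]
        regular_on_component) (auto simp: psi_dom_def)
  then show ?thesis
    by (rule regular_on_cong) (auto simp: psi_dom_def intro!: psi_map_nth)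
qed


section \<open>The moment map on the positive orthant\<close>

definition positive_orthant :: "(real ^ 'n) set" where
  "positive_orthant = {x. \<forall>i. 0 < x $ i}"

definition real_laurent_poly ::
  "(int ^ 'n) set \<Rightarrow> (int ^ 'n \<Rightarrow> real) \<Rightarrow> real ^ 'n \<Rightarrow> real" where
  "real_laurent_poly A w x = (\<Sum>a\<in>A. w a * laurent_monomial x a)"

text \<open>The algebraic moment map of toric geometry. It is the real form of
  \<open>psi_map\<close>: the two agree at positive real points by
  \<open>psi_map_complex_vec\<close>.\<close>

definition moment_map ::
  "(int ^ 'n) set \<Rightarrow> (int ^ 'n \<Rightarrow> real) \<Rightarrow> real ^ 'n \<Rightarrow> real ^ 'n" where
  "moment_map A w x =
     (\<Sum>a\<in>A. (w a * laurent_monomial x a / real_laurent_poly A w x) *\<^sub>R real_vec a)"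

lemma positive_orthant_nth: "x \<in> positive_orthant \<Longrightarrow> 0 < x $ i"
  by (simp add: positive_orthant_def)

lemma open_positive_orthant: "open positive_orthant"
  unfolding positive_orthant_def Collect_all_eq
  by (intro open_INT ballI open_Collect_less continuous_intros finite)

lemma positive_orthant_nonempty: "positive_orthant \<noteq> {}"
proof -
  have "(\<chi> i. 1) \<in> positive_orthant" by (simp add: positive_orthant_def)
  then show ?thesis by blast
qed

lemma real_laurent_poly_pos:
  assumes "finite A" "A \<noteq> {}" "\<And>a. a \<in> A \<Longrightarrow> 0 < w a" "x \<in> positive_orthant"
  shows "0 < real_laurent_poly A w x"
  unfolding real_laurent_poly_def
  using assms by (intro sum_pos mult_pos_pos laurent_monomial_pos positive_orthant_nth) auto

lemma laurent_poly_complex_vec: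
  "laurent_poly A w (complex_vec x) = of_real (real_laurent_poly A w x)"
  by (simp add: laurent_poly_def real_laurent_poly_def laurent_monomial_complex_vec)

lemma complex_vec_mem_psi_dom:
  assumes "finite A" "A \<noteq> {}" "\<And>a. a \<in> A \<Longrightarrow> 0 < w a" "x \<in> positive_orthant"
  shows "complex_vec x \<in> psi_dom A w"
proof -
  have "x $ i \<noteq> 0" for i using positive_orthant_nth[OF assms(4), of i] by simp
  moreover have "real_laurent_poly A w x \<noteq> 0"
    using real_laurent_poly_pos[of A w x, OF assms] by simp
  ultimately show ?thesis by (simp add: psi_dom_def laurent_poly_complex_vec)
qed

lemma psi_map_complex_vec:
  assumes "x \<in> positive_orthant"
  shows "psi_map A w (complex_vec x) = complex_vec (moment_map A w x)"
proof -
  have "complex_vec x $ i \<noteq> 0" for i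
    using positive_orthant_nth[OF assms, of i] by simp
  then have "psi_map A w (complex_vec x) $ i = complex_vec (moment_map A w x) $ i" for i
    by (subst psi_map_nth)
      (auto simp: laurent_monomial_complex_vec laurent_poly_complex_vec moment_map_def
        real_vec_def sum_component sum_divide_distrib intro!: sum.cong)
  then show ?thesis by (simp add: vec_eq_iff)
qed

lemma continuous_on_moment_map:
  assumes "finite A" "A \<noteq> {}" "\<And>a. a \<in> A \<Longrightarrow> 0 < w a"
  shows "continuous_on positive_orthant (moment_map A w)"
proof -
  have "continuous_on positive_orthant (\<lambda>x :: real ^ 'a. laurent_monomial x a)" for a
    unfolding laurent_monomial_def
    by (intro continuous_intros) (auto dest: positive_orthant_nth[THEN less_imp_neq])
  then show ?thesis
    using real_laurent_poly_pos[OF assms]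
    unfolding moment_map_def real_laurent_poly_def[abs_def]
    by (intro continuous_intros) (force simp: real_laurent_poly_def)+
qed

text \<open>After division by the weights, the coordinates are monomials over the common factor
  \<open>real_laurent_poly A w x\<close>. The exponents of \<open>primitive_axis\<close> eliminate
  this factor and return each \<open>x $ i\<close>.\<close>

lemma inj_toric_coordinates:
  assumes A: "finite A" "primitive A" and w: "\<And>a. a \<in> A \<Longrightarrow> 0 < w a"
    and x: "x \<in> positive_orthant" and y: "y \<in> positive_orthant"
    and eq: "\<And>a. a \<in> A \<Longrightarrow> w a * laurent_monomial x a / real_laurent_poly A w x
      = w a * laurent_monomial y a / real_laurent_poly A w y"
  shows "x = y"
proof -
  have eq': "laurent_monomial x a / real_laurent_poly A w x
      = laurent_monomial y a / real_laurent_poly A w y" if "a \<in> A" for a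
    using eq[OF that] w[OF that]
    by (simp only: times_divide_eq_right[symmetric] mult_left_cancel[OF less_imp_neq[THEN not_sym]])
  have nz: "real_laurent_poly A w u \<noteq> 0" "\<And>i. u $ i \<noteq> 0" if "u \<in> positive_orthant" for u
    using real_laurent_poly_pos[of A w u, OF A(1) primitive_nonempty[OF A(2)] w that]
      positive_orthant_nth[OF that] by (metis less_irrefl)+
  have "x $ i = y $ i" for i
  proof -
    obtain c where c: "(\<Sum>a\<in>A. c a) = 0" "\<And>j. (\<Sum>a\<in>A. c a * a $ j) = (if j = i then 1 else 0)"
      using primitive_axis[OF A(2)] by blast
    have "x $ i = (\<Prod>a\<in>A. (laurent_monomial x a / real_laurent_poly A w x) powi c a)"
      by (rule prod_laurent_monomial_power_int[OF nz(2)[OF x] nz(1)[OF x] c, symmetric])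
    also have "\<dots> = (\<Prod>a\<in>A. (laurent_monomial y a / real_laurent_poly A w y) powi c a)"
      using eq' by (intro prod.cong) auto
    also have "\<dots> = y $ i"
      by (rule prod_laurent_monomial_power_int[OF nz(2)[OF y] nz(1)[OF y] c])
    finally show ?thesis .
  qed
  then show ?thesis by (simp add: vec_eq_iff)
qed


section \<open>Projective points and patches\<close>

text \<open>\<open>nonzero_coords\<close> admits only extensional functions, so a representative
  such as \<lambda>a. \<beta> a x has to be restricted to \<open>A\<close> before it names a point
  of \<open>RP A\<close>.\<close>

lemma proj_point_restrict: "proj_point A (restrict v A) = proj_point A v"
proof -
  have "(\<lambda>a\<in>A. c * restrict v A a) = (\<lambda>a\<in>A. c * v a)" for c
    by (rule restrict_ext) simp
  then show ?thesis unfolding proj_point_def by (simp only:)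
qed

lemma proj_point_eqD:
  assumes "proj_point A u = proj_point A v"
  shows "\<exists>c. c \<noteq> 0 \<and> (\<forall>a\<in>A. u a = c * v a)"
proof -
  have "(\<lambda>a\<in>A. 1 * u a) \<in> proj_point A u"
    unfolding proj_point_def by (intro CollectI exI[of _ 1] conjI) simp_all
  then have "(\<lambda>a\<in>A. 1 * u a) \<in> proj_point A v" by (simp only: assms)
  then obtain c where c: "c \<noteq> 0" "(\<lambda>a\<in>A. 1 * u a) = (\<lambda>a\<in>A. c * v a)"
    unfolding proj_point_def by (elim CollectE exE conjE)
  have "u a = c * v a" if "a \<in> A" for a
    using fun_cong[OF c(2), of a] that by simp
  then show ?thesis using c(1) by blast
qed

lemma proj_point_mem_RP:
  assumes "\<exists>a\<in>A. v a \<noteq> 0"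
  shows "proj_point A v \<in> RP A"
proof -
  have "restrict v A \<in> nonzero_coords A" using assms by (auto simp: nonzero_coords_def)
  then show ?thesis
    unfolding RP_def proj_point_restrict[of A v, symmetric] by (rule imageI)
qed

lemma patch_sum_pos:
  assumes "finite A" "patch A \<beta>" "x \<in> Delta A"
  shows "0 < (\<Sum>a\<in>A. \<beta> a x)"
proof -
  have nn: "\<forall>a\<in>A. 0 \<le> \<beta> a x" and "\<exists>a\<in>A. \<beta> a x \<noteq> 0"
    using assms(2,3) unfolding patch_def by blast+
  then obtain a where "a \<in> A" "0 < \<beta> a x" by (metis order_le_less)
  then show ?thesis using nn assms(1) by (intro sum_pos2) auto
qed

lemma sum_normalized: "(\<Sum>b\<in>A. \<beta> b x) \<noteq> 0 \<Longrightarrow> (\<Sum>a\<in>A. normalized A \<beta> a x) = 1"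
  unfolding normalized_def sum_divide_distrib[symmetric] by simp

text \<open>Coordinate functions are affine, which forces the tautological map to fix each point.
  Conversely \<open>L\<close> commutes with the combination, and the constant \<open>c\<close> is
  reproduced because the normalized functions sum to one.\<close>

lemma linear_precision_iff:
  assumes nz: "\<And>x. x \<in> Delta A \<Longrightarrow> (\<Sum>b\<in>A. \<beta> b x) \<noteq> 0"
  shows "linear_precision A \<beta> \<longleftrightarrow> (\<forall>x\<in>Delta A. tautological_map A \<beta> x = x)"
proof
  assume lp: "linear_precision A \<beta>"
  have "tautological_map A \<beta> x $ i = x $ i" if "x \<in> Delta A" for x i
  proof -
    have "linear (\<lambda>x :: real ^ 'a. x $ i)" by (simp add: bounded_linear.linear bounded_linear_vec_nth)
    then have "x $ i + 0 = (\<Sum>a\<in>A. normalized A \<beta> a x * (real_vec a $ i + 0))"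
      using lp that unfolding linear_precision_def by blast
    then show ?thesis by (simp add: tautological_map_def sum_component)
  qed
  then show "\<forall>x\<in>Delta A. tautological_map A \<beta> x = x" by (simp add: vec_eq_iff)
next
  assume taut: "\<forall>x\<in>Delta A. tautological_map A \<beta> x = x"
  show "linear_precision A \<beta>"
    unfolding linear_precision_def
  proof (intro allI impI ballI)
    fix L :: "real ^ 'a \<Rightarrow> real" and c x
    assume L: "linear L" and x: "x \<in> Delta A"
    have "L x = L (\<Sum>a\<in>A. normalized A \<beta> a x *\<^sub>R real_vec a)"
      using taut x by (simp add: tautological_map_def)
    also have "\<dots> = (\<Sum>a\<in>A. normalized A \<beta> a x * L (real_vec a))"
      by (simp add: linear_sum[OF L] linear_scale[OF L])
    finally show "L x + c = (\<Sum>a\<in>A. normalized A \<beta> a x * (L (real_vec a) + c))"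
      by (simp add: distrib_left sum.distrib sum_distrib_right[symmetric] sum_normalized[of \<beta> x A, OF nz[OF x]])
  qed
qed

lemma rational_function_on_cong:
  assumes "\<And>x. x \<in> S \<Longrightarrow> f x = g x"
  shows "rational_function_on S f \<longleftrightarrow> rational_function_on S g"
proof -
  have "(\<forall>x\<in>S. q x \<noteq> 0 \<longrightarrow> f x = p x / q x) \<longleftrightarrow> (\<forall>x\<in>S. q x \<noteq> 0 \<longrightarrow> g x = p x / q x)" for p q
    by (intro ball_cong refl) (simp only: assms)
  then show ?thesis unfolding rational_function_on_def by (simp only:)
qed

lemma compact_Delta: "finite A \<Longrightarrow> compact (Delta A)"
  by (simp add: Delta_def finite_imp_compact_convex_hull)

section \<open>The toric coordinates and the inverse of the tautological map\<close>

locale proper_toric_patch =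
  fixes A :: "(int ^ 'n) set" and w :: "int ^ 'n \<Rightarrow> real"
    and \<beta> :: "int ^ 'n \<Rightarrow> real ^ 'n \<Rightarrow> real"
  assumes finite_A: "finite A" and primitive_A: "primitive A"
    and w_pos: "\<And>a. a \<in> A \<Longrightarrow> 0 < w a"
    and toric: "toric_patch A w \<beta>"
    and proper: "proper_patch A \<beta>"
begin

abbreviation "\<tau> \<equiv> tautological_map A \<beta>"

lemma patch_\<beta>: "patch A \<beta>"
  using toric by (simp add: toric_patch_def)

lemma nonempty_A: "A \<noteq> {}"
  using primitive_A by (rule primitive_nonempty)

lemma sum_\<beta>_nonzero: "x \<in> Delta A \<Longrightarrow> (\<Sum>a\<in>A. \<beta> a x) \<noteq> 0"
  using patch_sum_pos[OF finite_A patch_\<beta>, of x] by simp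

lemma real_laurent_pos: "x \<in> positive_orthant \<Longrightarrow> 0 < real_laurent_poly A w x"
  by (rule real_laurent_poly_pos[OF finite_A nonempty_A w_pos])

text \<open>The torus orbit lies in its closure, which is the image of the polytope under the patch.
  The scalar relating the two representatives of a projective point cancels under
  normalization.\<close>

lemma toric_coordinates_attained:
  assumes x: "x \<in> positive_orthant"
  shows "\<exists>z\<in>Delta A. \<tau> z = moment_map A w x \<and>
    (\<forall>a\<in>A. normalized A \<beta> a z = w a * laurent_monomial x a / real_laurent_poly A w x)"
proof -
  let ?v = "\<lambda>a. w a * laurent_monomial x a"
  let ?O = "{proj_point A (\<lambda>a. w a * laurent_monomial x a) | x :: real ^ 'n. \<forall>i. 0 < x $ i}"
  have "?O \<subseteq> topspace (RP_topology A)"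
  proof
    fix P assume "P \<in> ?O"
    then obtain u :: "real ^ 'n" where u: "\<forall>i. 0 < u $ i"
      and P: "P = proj_point A (\<lambda>a. w a * laurent_monomial u a)" by blast
    obtain a where "a \<in> A" using nonempty_A by blast
    then have "\<exists>a\<in>A. w a * laurent_monomial u a \<noteq> 0"
      using w_pos[of a] laurent_monomial_pos[of u a] u by (intro bexI[of _ a]) auto
    then show "P \<in> topspace (RP_topology A)"
      unfolding P topspace_RP_topology by (rule proj_point_mem_RP)
  qed
  then have "?O \<subseteq> X_variety A w" unfolding X_variety_def by (rule closure_of_subset)
  moreover have "proj_point A ?v \<in> ?O"
    using positive_orthant_nth[OF x] by (intro CollectI exI[of _ x] conjI refl allI)
  ultimately have "proj_point A ?v \<in> X_variety A w" by (rule subsetD)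
  then have "proj_point A ?v \<in> (\<lambda>x. proj_point A (\<lambda>a. \<beta> a x)) ` Delta A"
    using toric by (simp only: toric_patch_def)
  then obtain z where z: "z \<in> Delta A" "proj_point A ?v = proj_point A (\<lambda>a. \<beta> a z)"
    by (elim imageE)
  obtain c where c: "c \<noteq> 0" "\<And>a. a \<in> A \<Longrightarrow> \<beta> a z = c * ?v a"
    using proj_point_eqD[OF z(2)[symmetric]] by auto
  have "(\<Sum>a\<in>A. \<beta> a z) = c * real_laurent_poly A w x"
    unfolding real_laurent_poly_def sum_distrib_left by (intro sum.cong refl c(2))
  then have nrm: "normalized A \<beta> a z = ?v a / real_laurent_poly A w x" if "a \<in> A" for a
    using c(1) c(2)[OF that] by (simp add: normalized_def mult_divide_mult_cancel_left)
  have "\<tau> z = moment_map A w x"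
    unfolding tautological_map_def moment_map_def
    by (intro sum.cong refl) (simp only: nrm)
  then show ?thesis using z(1) nrm by blast
qed

abbreviation "\<sigma> \<equiv> inv_into (Delta A) \<tau>"

text \<open>\<open>proper_patch\<close> only asserts that some inverse exists. On the polytope it
  agrees with \<open>inv_into\<close>, which provides a fixed name for it.\<close>

lemma tautological_homeomorphism: "homeomorphism (Delta A) (Delta A) \<tau> \<sigma>"
proof -
  obtain g where g: "homeomorphism (Delta A) (Delta A) \<tau> g"
    using proper unfolding proper_patch_def by blast
  have "inj_on \<tau> (Delta A)"
    by (rule inj_on_inverseI[of _ g]) (rule homeomorphism_apply1[OF g])
  have "\<sigma> y = g y" if "y \<in> Delta A" for y
    using g that by (intro inv_into_f_eq[OF \<open>inj_on \<tau> (Delta A)\<close>]) (auto simp: homeomorphism_def)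
  then show ?thesis by (intro homeomorphism_cong[OF g]) auto
qed

lemma inj_on_tautological_map: "inj_on \<tau> (Delta A)"
  by (rule inj_on_inverseI[of _ \<sigma>]) (rule homeomorphism_apply1[OF tautological_homeomorphism])

lemma tautological_map_mem: "z \<in> Delta A \<Longrightarrow> \<tau> z \<in> Delta A"
  using homeomorphism_image1[OF tautological_homeomorphism] by blast

lemma \<sigma>_mem: "y \<in> Delta A \<Longrightarrow> \<sigma> y \<in> Delta A"
  using homeomorphism_image2[OF tautological_homeomorphism] by blast

lemma \<tau>_\<sigma>: "y \<in> Delta A \<Longrightarrow> \<tau> (\<sigma> y) = y"
  by (rule homeomorphism_apply2[OF tautological_homeomorphism])

lemma moment_map_mem_Delta:
  assumes "x \<in> positive_orthant"
  shows "moment_map A w x \<in> Delta A"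
proof -
  obtain z where "z \<in> Delta A" "\<tau> z = moment_map A w x"
    using toric_coordinates_attained[OF assms] by blast
  then show ?thesis using tautological_map_mem[of z] by simp
qed

text \<open>Both values are attained by \<tau>, and injectivity of \<tau> makes the two patch points
  equal. Then all toric coordinates agree, and these determine the positive point.\<close>

lemma inj_on_moment_map: "inj_on (moment_map A w) positive_orthant"
proof (rule inj_onI)
  fix x y assume x: "x \<in> positive_orthant" and y: "y \<in> positive_orthant"
    and eq: "moment_map A w x = moment_map A w y"
  obtain z where z: "z \<in> Delta A" "\<tau> z = moment_map A w x"
    "\<And>a. a \<in> A \<Longrightarrow> normalized A \<beta> a z = w a * laurent_monomial x a / real_laurent_poly A w x"
    using toric_coordinates_attained[OF x] by blast
  obtain z' where z': "z' \<in> Delta A" "\<tau> z' = moment_map A w y"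
    "\<And>a. a \<in> A \<Longrightarrow> normalized A \<beta> a z' = w a * laurent_monomial y a / real_laurent_poly A w y"
    using toric_coordinates_attained[OF y] by blast
  have "z = z'" using inj_onD[OF inj_on_tautological_map] z(1,2) z'(1,2) eq by simp
  then show "x = y"
    using inj_toric_coordinates[OF finite_A primitive_A w_pos x y] z(3) z'(3) by simp
qed

section \<open>The image of the positive orthant: openness and density in the polytope\<close>

definition moment_image :: "(real ^ 'n) set" where
  "moment_image = moment_map A w ` positive_orthant"

lemma moment_image_subset: "moment_image \<subseteq> Delta A"
  unfolding moment_image_def using moment_map_mem_Delta by blast

lemma open_moment_image: "open moment_image"
  unfolding moment_image_def
  by (rule invariance_of_domain[OF continuous_on_moment_map[of A w, OF finite_A nonempty_A w_pos]
        open_positive_orthant inj_on_moment_map])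

lemma moment_image_nonempty: "moment_image \<noteq> {}"
  unfolding moment_image_def using positive_orthant_nonempty by blast

text \<open>The sets \<open>proj_point A ` {v. norm (\<Sum>a. v a *\<^sub>R (a - y)) < \<epsilon> * \<bar>\<Sum>a. v a\<bar>}\<close> are open
  neighbourhoods in the projective space, being given by a condition invariant under scaling.\<close>

lemma moment_image_dense:
  assumes y: "y \<in> Delta A" and \<epsilon>: "0 < \<epsilon>"
  shows "\<exists>u\<in>moment_image. dist u y < \<epsilon>"
proof -
  define z where "z = \<sigma> y"
  have z: "z \<in> Delta A" "\<tau> z = y"
    unfolding z_def by (rule \<sigma>_mem[OF y], rule \<tau>_\<sigma>[OF y])
  define s :: "(int ^ 'n \<Rightarrow> real) \<Rightarrow> real" where "s v = (\<Sum>a\<in>A. v a)" for v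
  define m :: "(int ^ 'n \<Rightarrow> real) \<Rightarrow> real ^ 'n" where "m v = (\<Sum>a\<in>A. v a *\<^sub>R (real_vec a - y))" for v
  \<comment> \<open>If \<open>s v = 1\<close>, then \<open>0 < h v\<close> says that the combination
    of the exponents with coefficients \<open>v\<close> lies within \<epsilon> of
    \<open>y\<close>.\<close>
  define h where "h v = \<epsilon> * \<bar>s v\<bar> - norm (m v)" for v
  have m_eq: "m v = (\<Sum>a\<in>A. v a *\<^sub>R real_vec a) - s v *\<^sub>R y" for v
    by (simp add: m_def s_def scaleR_right_diff_distrib sum_subtractf scaleR_sum_left)
  have h_scale: "h v = \<bar>c\<bar> * h u" if "\<And>a. a \<in> A \<Longrightarrow> v a = c * u a" for u v c
  proof -
    have "s v = c * s u" unfolding s_def sum_distrib_left using that by (intro sum.cong) auto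
    moreover have "m v = c *\<^sub>R m u"
      unfolding m_def scaleR_sum_right using that by (intro sum.cong) auto
    ultimately show ?thesis by (simp add: h_def abs_mult algebra_simps)
  qed
  have h_pos: "0 < h v \<longleftrightarrow> 0 < h u" if "proj_point A v = proj_point A u" for u v
  proof -
    obtain c where "c \<noteq> 0" "\<And>a. a \<in> A \<Longrightarrow> v a = c * u a"
      using proj_point_eqD[OF \<open>proj_point A v = proj_point A u\<close>] by auto
    then show ?thesis using h_scale[of v c u] by (simp add: zero_less_mult_iff)
  qed
  define T where "T = {P \<in> RP A. \<exists>v. P = proj_point A v \<and> 0 < h v}"
  have T_iff: "proj_point A v \<in> T \<longleftrightarrow> proj_point A v \<in> RP A \<and> 0 < h v" for v
    unfolding T_def using h_pos by blast
  have h_cont: "continuous_map (subtopology (powertop_real A) (nonzero_coords A)) euclideanreal h"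
  proof -
    have coord: "continuous_map (powertop_real A) euclideanreal (\<lambda>v. v a)" if "a \<in> A" for a
      using that by (rule continuous_map_product_coordinates)
    have "continuous_map (powertop_real A) euclidean (\<lambda>v. v a *\<^sub>R (real_vec a - y))" if "a \<in> A" for a
      using continuous_map_compose[OF coord[OF that], of euclidean "\<lambda>r. r *\<^sub>R (real_vec a - y)"]
      by (simp add: o_def continuous_on_scaleR continuous_on_id continuous_on_const)
    then have "continuous_map (powertop_real A) euclideanreal h"
      unfolding h_def s_def m_def using finite_A
      by (intro continuous_map_diff continuous_map_real_mult_left continuous_map_real_abs
          continuous_map_norm continuous_map_sum coord)
    then show ?thesis by (rule continuous_map_from_subtopology)
  qed
  have "openin (RP_topology A) T"
    unfolding openin_RP_topology
  proof
    show "T \<subseteq> RP A" by (auto simp: T_def)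
    have "{v \<in> nonzero_coords A. proj_point A v \<in> T} =
        {v \<in> topspace (subtopology (powertop_real A) (nonzero_coords A)). h v \<in> {0<..}}"
      by (auto simp: T_iff RP_def nonzero_coords_def)
    also have "openin (subtopology (powertop_real A) (nonzero_coords A)) \<dots>"
      by (rule openin_continuous_map_preimage[OF h_cont]) simp
    finally show "openin (subtopology (powertop_real A) (nonzero_coords A))
        {v \<in> nonzero_coords A. proj_point A v \<in> T}" .
  qed
  moreover have "proj_point A (\<lambda>a. \<beta> a z) \<in> T"
  proof -
    let ?N = "\<lambda>a. normalized A \<beta> a z"
    have "s ?N = 1" unfolding s_def by (rule sum_normalized) (rule sum_\<beta>_nonzero[OF z(1)])
    moreover have "m ?N = 0" using z(2) \<open>s ?N = 1\<close> by (simp add: m_eq tautological_map_def)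
    ultimately have "0 < h ?N" using \<epsilon> by (simp add: h_def)
    then have "0 < h (\<lambda>a. \<beta> a z)"
      using h_scale[of ?N "inverse (\<Sum>b\<in>A. \<beta> b z)" "\<lambda>a. \<beta> a z"]
      by (simp add: normalized_def divide_inverse mult.commute zero_less_mult_iff)
    then show ?thesis
      using patch_\<beta> z(1) by (auto simp: T_iff patch_def intro!: proj_point_mem_RP)
  qed
  moreover have "proj_point A (\<lambda>a. \<beta> a z) \<in> X_variety A w"
    using toric z(1) unfolding toric_patch_def by blast
  \<comment> \<open>\<open>T\<close> is an open neighbourhood of a point in the closure of the torus
    orbit, so it contains an orbit point.\<close>
  ultimately obtain x :: "real ^ 'n" where x: "\<forall>i. 0 < x $ i"
    and xT: "proj_point A (\<lambda>a. w a * laurent_monomial x a) \<in> T"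
    unfolding X_variety_def in_closure_of by blast
  have x_pos: "x \<in> positive_orthant" using x by (simp add: positive_orthant_def)
  let ?f = "real_laurent_poly A w x"
  let ?N = "\<lambda>a. w a * laurent_monomial x a / ?f"
  have f: "0 < ?f" by (rule real_laurent_pos[OF x_pos])
  have "0 < h (\<lambda>a. w a * laurent_monomial x a)" using xT by (simp add: T_iff)
  then have "0 < h ?N"
    using h_scale[of ?N "inverse ?f" "\<lambda>a. w a * laurent_monomial x a"] f
    by (simp add: divide_inverse mult.commute)
  moreover have "s ?N = 1"
    using f by (simp add: s_def sum_divide_distrib[symmetric] real_laurent_poly_def[symmetric])
  moreover have "m ?N = moment_map A w x - y"
    using \<open>s ?N = 1\<close> by (simp add: m_eq moment_map_def)
  ultimately have "dist (moment_map A w x) y < \<epsilon>" by (simp add: h_def dist_norm)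
  then show ?thesis unfolding moment_image_def using x_pos by blast
qed

text \<open>Each ball around a point of the polytope meets \<open>moment_image\<close> in a nonempty
  open set, and such a set contains a real point of \<open>V\<close>. The points where equality is
  assumed are therefore dense in the polytope, and continuity does the rest.\<close>

lemma eq_on_Delta_if_eq_on_dense:
  assumes V: "principal_open V" "V \<noteq> {}"
    and cont: "continuous_on (Delta A) f" "continuous_on (Delta A) h"
    and eq: "\<And>y. y \<in> moment_image \<Longrightarrow> complex_vec y \<in> V \<Longrightarrow> f y = h y"
    and y: "y \<in> Delta A"
  shows "f y = (h y :: real)"
proof -
  define D where "D = {y \<in> moment_image. complex_vec y \<in> V}"
  have "closure D \<subseteq> Delta A"
    using moment_image_subset compact_imp_closed[OF compact_Delta[OF finite_A]]
    by (intro closure_minimal) (auto simp: D_def)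
  moreover have "y \<in> closure D"
    unfolding closure_approachable
  proof (intro allI impI)
    fix e :: real assume "0 < e"
    have "open (moment_image \<inter> ball y e)" using open_moment_image by (simp add: open_Int)
    moreover have "moment_image \<inter> ball y e \<noteq> {}"
      using moment_image_dense[OF y \<open>0 < e\<close>] by (auto simp: dist_commute)
    ultimately obtain u where "u \<in> moment_image \<inter> ball y e" "complex_vec u \<in> V"
      using principal_open_meets_open_reals[OF V] by blast
    then show "\<exists>u\<in>D. dist u y < e" by (auto simp: D_def dist_commute)
  qed
  moreover have "continuous_on (Delta A) (\<lambda>y. f y - h y)"
    using cont by (intro continuous_intros)
  ultimately have "f y - h y = 0"
    by (intro continuous_constant_on_closure[of D "\<lambda>y. f y - h y" 0 y])
      (auto intro: continuous_on_subset simp: D_def eq)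
  then show ?thesis by simp
qed

text \<open>The blending functions of the unique reparametrization with linear precision.\<close>

definition blending :: "int ^ 'n \<Rightarrow> real ^ 'n \<Rightarrow> real" where
  "blending a = normalized A \<beta> a \<circ> \<sigma>"

lemma blending_tautological_map:
  "z \<in> Delta A \<Longrightarrow> blending a (\<tau> z) = normalized A \<beta> a z"
  by (simp add: blending_def inv_into_f_f[OF inj_on_tautological_map])

lemma continuous_on_blending:
  assumes "a \<in> A"
  shows "continuous_on (Delta A) (blending a)"
proof -
  have "continuous_on (Delta A) (normalized A \<beta> a)"
    using patch_\<beta> assms sum_\<beta>_nonzero unfolding normalized_def[abs_def] patch_def
    by (intro continuous_intros) auto
  then show ?thesis
    unfolding blending_def
    using tautological_homeomorphism
    by (intro continuous_on_compose) (auto simp: homeomorphism_def)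
qed

lemma blending_moment_map:
  assumes "x \<in> positive_orthant" "a \<in> A"
  shows "blending a (moment_map A w x) = w a * laurent_monomial x a / real_laurent_poly A w x"
proof -
  obtain z where "z \<in> Delta A" "\<tau> z = moment_map A w x"
    "\<forall>a\<in>A. normalized A \<beta> a z = w a * laurent_monomial x a / real_laurent_poly A w x"
    using toric_coordinates_attained[OF assms(1)] by blast
  then show ?thesis using blending_tautological_map[of z a] assms(2) by simp
qed

text \<open>Linear precision of a reparametrization by \<psi> means that \<tau> after \<psi> is the
  identity on the polytope, so its normalized functions coincide there with \<open>blending\<close>.
  The choice of \<sigma> for \<psi> gives existence.\<close>

lemma rational_linear_precision_iff_blending:
  "rational_linear_precision A \<beta> \<longleftrightarrow> (\<forall>a\<in>A. rational_function_on (Delta A) (blending a))"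
proof -
  have nrm: "normalized A (reparametrize \<beta> \<psi>) a y = normalized A \<beta> a (\<psi> y)" for \<psi> a y
    by (simp add: normalized_def reparametrize_def)
  have taut: "tautological_map A (reparametrize \<beta> \<psi>) y = \<tau> (\<psi> y)" for \<psi> y
    by (simp add: tautological_map_def nrm)
  have mem: "\<psi> y \<in> Delta A" if "homeomorphism (Delta A) (Delta A) \<psi> \<psi>'" "y \<in> Delta A" for \<psi> \<psi>' y
    using homeomorphism_image1[OF that(1)] that(2) by blast
  have lp: "linear_precision A (reparametrize \<beta> \<psi>) \<longleftrightarrow> (\<forall>y\<in>Delta A. \<tau> (\<psi> y) = y)"
    if \<psi>: "homeomorphism (Delta A) (Delta A) \<psi> \<psi>'" for \<psi> \<psi>'
  proof -
    have "(\<Sum>b\<in>A. reparametrize \<beta> \<psi> b y) \<noteq> 0" if "y \<in> Delta A" for y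
      using sum_\<beta>_nonzero[OF mem[OF \<psi> that]] by (simp add: reparametrize_def)
    then show ?thesis by (rule linear_precision_iff[of A "reparametrize \<beta> \<psi>", unfolded taut])
  qed
  have rat: "(\<forall>a\<in>A. rational_function_on (Delta A) (normalized A (reparametrize \<beta> \<psi>) a)) \<longleftrightarrow>
      (\<forall>a\<in>A. rational_function_on (Delta A) (blending a))"
    if \<psi>: "homeomorphism (Delta A) (Delta A) \<psi> \<psi>'" and id: "\<forall>y\<in>Delta A. \<tau> (\<psi> y) = y" for \<psi> \<psi>'
  proof -
    have "normalized A (reparametrize \<beta> \<psi>) a y = blending a y" if "y \<in> Delta A" for a y
    proof -
      have "\<tau> (\<psi> y) = y" using id that by blast
      then show ?thesis using blending_tautological_map[OF mem[OF \<psi> that], of a] by (simp only: nrm)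
    qed
    then show ?thesis by (intro ball_cong refl rational_function_on_cong)
  qed
  have \<sigma>: "homeomorphism (Delta A) (Delta A) \<sigma> \<tau>"
    by (rule homeomorphism_symD[OF tautological_homeomorphism])
  show ?thesis
  proof
    assume "rational_linear_precision A \<beta>"
    then obtain \<psi> \<psi>' where \<psi>: "homeomorphism (Delta A) (Delta A) \<psi> \<psi>'"
      and "linear_precision A (reparametrize \<beta> \<psi>)"
      and r: "\<forall>a\<in>A. rational_function_on (Delta A) (normalized A (reparametrize \<beta> \<psi>) a)"
      unfolding rational_linear_precision_def by (elim conjE exE)
    then have id: "\<forall>y\<in>Delta A. \<tau> (\<psi> y) = y" by (simp only: lp[OF \<psi>])
    from r show "\<forall>a\<in>A. rational_function_on (Delta A) (blending a)"
      unfolding rat[OF \<psi> id] .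
  next
    assume r: "\<forall>a\<in>A. rational_function_on (Delta A) (blending a)"
    have id: "\<forall>y\<in>Delta A. \<tau> (\<sigma> y) = y" by (intro ballI \<tau>_\<sigma>)
    then have "linear_precision A (reparametrize \<beta> \<sigma>)" by (simp only: lp[OF \<sigma>])
    moreover have "\<forall>a\<in>A. rational_function_on (Delta A) (normalized A (reparametrize \<beta> \<sigma>) a)"
      using r unfolding rat[OF \<sigma> id] .
    ultimately show "rational_linear_precision A \<beta>"
      unfolding rational_linear_precision_def using proper \<sigma>
      by (intro conjI exI[of _ \<sigma>] exI[of _ \<tau>])
  qed
qed

section \<open>Rational blending functions and the birational inverse of
  \<open>psi_map\<close>\<close>

lemma rational_map_psi_map: "rational_map (psi_dom A w) (psi_map A w)"
proof -
  obtain x :: "real ^ 'n" where x: "x \<in> positive_orthant"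
    using positive_orthant_nonempty by blast
  have "psi_dom A w \<noteq> {}"
    using complex_vec_mem_psi_dom[of A w x, OF finite_A nonempty_A w_pos x] by blast
  then show ?thesis
    by (simp add: rational_map_iff principal_open_psi_dom regular_on_psi_map)
qed

lemma birational_isomorphism_if_rational_blending:
  assumes rat: "\<forall>a\<in>A. rational_function_on (Delta A) (blending a)"
  shows "birational_isomorphism (psi_dom A w) (psi_map A w)"
proof -
  let ?U = "psi_dom A w" and ?F = "psi_map A w"
  let ?rep = "\<lambda>a P Q. polynomial_fun P \<and> polynomial_fun Q \<and> (\<exists>z. Q z \<noteq> 0) \<and>
      (\<forall>y\<in>Delta A. Q (complex_vec y) \<noteq> 0 \<longrightarrow>
        of_real (blending a y) = P (complex_vec y) / (Q (complex_vec y) :: complex))"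
  have "\<exists>P Q. ?rep a P Q"
    if a: "a \<in> A" for a
  proof -
    obtain p q y where pq: "polynomial_fun p" "polynomial_fun q" "q y \<noteq> 0"
      "\<forall>x\<in>Delta A. q x \<noteq> 0 \<longrightarrow> blending a x = p x / q x"
      using rat a unfolding rational_function_on_def by blast
    obtain P where P: "polynomial_fun P" "\<And>y. P (complex_vec y) = of_real (p y)"
      using complexify_polynomial_fun[OF pq(1)] by blast
    obtain Q where Q: "polynomial_fun Q" "\<And>y. Q (complex_vec y) = of_real (q y)"
      using complexify_polynomial_fun[OF pq(2)] by blast
    have "Q (complex_vec y) \<noteq> 0" using Q(2) pq(3) by simp
    moreover have "\<forall>y\<in>Delta A. Q (complex_vec y) \<noteq> 0 \<longrightarrow>
        of_real (blending a y) = P (complex_vec y) / Q (complex_vec y)"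
      using pq(4) by (simp add: P(2) Q(2))
    ultimately show ?thesis
      by (intro exI[of _ P] exI[of _ Q] conjI P(1) Q(1) exI[of _ "complex_vec y"])
  qed
  then have "\<forall>a\<in>A. \<exists>P Q. ?rep a P Q" by (intro ballI)
  then obtain P where "\<forall>a\<in>A. \<exists>Q. ?rep a (P a) Q" by (rule bchoice[THEN exE])
  then obtain Q where "\<forall>a\<in>A. ?rep a (P a) (Q a)" by (rule bchoice[THEN exE])
  then have PQ: "\<And>a. a \<in> A \<Longrightarrow> polynomial_fun (P a)"
      "\<And>a. a \<in> A \<Longrightarrow> polynomial_fun (Q a)" "\<And>a. a \<in> A \<Longrightarrow> \<exists>z. Q a z \<noteq> 0"
    and eq: "\<And>a y. a \<in> A \<Longrightarrow> y \<in> Delta A \<Longrightarrow> Q a (complex_vec y) \<noteq> 0 \<Longrightarrow>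
        complex_of_real (blending a y) = P a (complex_vec y) / Q a (complex_vec y)"
    by simp_all
  have "\<exists>c. (\<Sum>a\<in>A. c a) = 0 \<and> (\<forall>j. (\<Sum>a\<in>A. c a * a $ j) = (if j = i then 1 else 0))" for i
    by (rule primitive_axis[OF primitive_A, of i]) blast
  then obtain c where c: "\<And>i. (\<Sum>a\<in>A. c i a) = 0"
      "\<And>i j. (\<Sum>a\<in>A. c i a * a $ j) = (if j = i then 1 else 0)"
    by metis
  \<comment> \<open>Nonvanishing numerators are required along with the denominators, since the
    exponents \<open>c i a\<close> may be negative.\<close>
  define V where "V = {z. (\<Prod>a\<in>A. P a z * Q a z) \<noteq> 0}"
  \<comment> \<open>Dividing by the weight leaves a fraction equal to monomial over Laurent
    polynomial on the moment image; \<open>prod_laurent_monomial_power_int\<close> then shows that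
    the product is the \<open>i\<close>-th coordinate of the preimage.\<close>
  define G where "G z = (\<chi> i. \<Prod>a\<in>A. (P a z / (Q a z * of_real (w a))) powi c i a)" for z
  have V_iff: "z \<in> V \<longleftrightarrow> (\<forall>a\<in>A. P a z \<noteq> 0 \<and> Q a z \<noteq> 0)" for z
    using finite_A by (auto simp: V_def)
  have V: "principal_open V"
    unfolding principal_open_def V_def using PQ(1,2)
    by (intro exI[of _ "\<lambda>z. \<Prod>a\<in>A. P a z * Q a z"] conjI polynomial_fun_prod polynomial_fun_mult) auto
  have w_nz: "w a \<noteq> 0" if "a \<in> A" for a using w_pos[OF that] by simp
  have G_regular: "regular_on V (\<lambda>z. G z $ i)" for i
    unfolding G_def vec_lambda_beta
    using PQ(1,2)
    by (intro regular_on_prod regular_on_power_int regular_on_divide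
        regular_on_mult[OF regular_on_polynomial_fun regular_on_const] regular_on_polynomial_fun)
      (auto simp: V_iff w_nz)
  have U: "principal_open ?U" by (rule principal_open_psi_dom)
  have mem_U: "complex_vec x \<in> ?U" if "x \<in> positive_orthant" for x
    by (rule complex_vec_mem_psi_dom[of A w, OF finite_A nonempty_A w_pos that])
  have G_moment: "G (complex_vec (moment_map A w x)) = complex_vec x"
    if x: "x \<in> positive_orthant" and xV: "complex_vec (moment_map A w x) \<in> V" for x
  proof -
    let ?y = "complex_vec (moment_map A w x)"
    have f: "of_real (real_laurent_poly A w x) \<noteq> (0 :: complex)"
      using real_laurent_pos[OF x] by simp
    have nz: "complex_vec x $ i \<noteq> 0" for i using positive_orthant_nth[OF x, of i] by simp
    have fac: "P a ?y / (Q a ?y * of_real (w a)) =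
        laurent_monomial (complex_vec x) a / of_real (real_laurent_poly A w x)" if a: "a \<in> A" for a
    proof -
      have "Q a ?y \<noteq> 0" using xV a V_iff by blast
      then have "P a ?y / Q a ?y = of_real (w a * laurent_monomial x a / real_laurent_poly A w x)"
        using eq[OF a moment_map_mem_Delta[OF x]] blending_moment_map[OF x a] by simp
      then have "P a ?y / Q a ?y / of_real (w a) =
          of_real (w a * laurent_monomial x a / real_laurent_poly A w x) / of_real (w a)"
        by (rule arg_cong)
      then show ?thesis using w_pos[OF a] by (simp add: laurent_monomial_complex_vec)
    qed
    have "G ?y $ i = complex_vec x $ i" for i
      unfolding G_def vec_lambda_beta prod_laurent_monomial_power_int[OF nz f c(1) c(2), symmetric]
      by (intro prod.cong refl) (simp only: fac)
    then show ?thesis unfolding vec_eq_iff by blast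
  qed
  \<comment> \<open>This point shows that \<open>V\<close> is nonempty and that both composites have
    nonempty domains.\<close>
  obtain x0 where x0: "x0 \<in> positive_orthant" "complex_vec (moment_map A w x0) \<in> V"
  proof -
    \<comment> \<open>A finite product of nonzero polynomials is nonzero: the real points where the
      new factor is nonzero form a nonempty open set, which meets the nonvanishing locus of the
      other factors.\<close>
    have "\<exists>z. \<forall>a\<in>B. Q a z \<noteq> 0" if "B \<subseteq> A" for B
      using finite_subset[OF that finite_A] that
    proof (induction B rule: finite_induct)
      case (insert b B)
      let ?R = "{z. (\<Prod>a\<in>B. Q a z) \<noteq> 0}"
      have R: "principal_open ?R"
        unfolding principal_open_def using PQ(2) insert.prems
        by (intro exI[of _ "\<lambda>z. \<Prod>a\<in>B. Q a z"] conjI polynomial_fun_prod) auto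
      have R_ne: "?R \<noteq> {}" using insert.IH insert.prems insert.hyps(1) by auto
      have b: "principal_open {z. Q b z \<noteq> 0}" "{z. Q b z \<noteq> 0} \<noteq> {}"
        unfolding principal_open_def using PQ(2,3)[of b] insert.prems by auto
      have "open {y. Q b (complex_vec y) \<noteq> 0}"
        using PQ(2)[of b] insert.prems
        by (intro open_Collect_neq continuous_on_const continuous_on_compose2[OF
              continuous_on_polynomial_fun continuous_on_complex_vec]) auto
      moreover have "{y. Q b (complex_vec y) \<noteq> 0} \<noteq> {}"
        using principal_open_meets_open_reals[OF b open_UNIV UNIV_not_empty] by auto
      ultimately obtain y where "Q b (complex_vec y) \<noteq> 0" "complex_vec y \<in> ?R"
        using principal_open_meets_open_reals[OF R R_ne] by blast
      then show ?case using insert.hyps(1) by (intro exI[of _ "complex_vec y"]) auto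
    qed simp
    then have ne: "{z. (\<Prod>a\<in>A. Q a z) \<noteq> 0} \<noteq> {}" using finite_A by auto
    have "principal_open {z. (\<Prod>a\<in>A. Q a z) \<noteq> 0}"
      unfolding principal_open_def using PQ(2)
      by (intro exI[of _ "\<lambda>z. \<Prod>a\<in>A. Q a z"] conjI polynomial_fun_prod) auto
    then obtain y where "y \<in> moment_image" "(\<Prod>a\<in>A. Q a (complex_vec y)) \<noteq> 0"
      using principal_open_meets_open_reals[OF _ ne open_moment_image moment_image_nonempty] by blast
    then obtain x where x: "x \<in> positive_orthant"
      and Q_nz: "\<And>a. a \<in> A \<Longrightarrow> Q a (complex_vec (moment_map A w x)) \<noteq> 0"
      using finite_A by (auto simp: moment_image_def)
    \<comment> \<open>Blending functions are strictly positive on the moment image, so their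
      numerators cannot vanish there.\<close>
    have "P a (complex_vec (moment_map A w x)) \<noteq> 0" if a: "a \<in> A" for a
    proof -
      have "0 < w a * laurent_monomial x a / real_laurent_poly A w x"
        by (intro divide_pos_pos mult_pos_pos w_pos[OF a] laurent_monomial_pos
            positive_orthant_nth[OF x] real_laurent_pos[OF x])
      then have "blending a (moment_map A w x) \<noteq> 0"
        unfolding blending_moment_map[OF x a] by (rule less_imp_neq[THEN not_sym])
      then show ?thesis
        using eq[OF a moment_map_mem_Delta[OF x] Q_nz[OF a]] by auto
    qed
    then show thesis using that[OF x] Q_nz V_iff by blast
  qed
  have F_x0: "?F (complex_vec x0) = complex_vec (moment_map A w x0)"
    by (rule psi_map_complex_vec[OF x0(1)])
  \<comment> \<open>The identity holds at positive real points by \<open>G_moment\<close> and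
    spreads over the whole domain of the composite by the identity principle.\<close>
  have GF: "G (?F x) = x" if x: "x \<in> ?U" "?F x \<in> V" for x
  proof -
    let ?W = "{x \<in> ?U. ?F x \<in> V}"
    have W: "principal_open ?W"
      by (rule principal_open_preimage[OF U regular_on_psi_map V])
    have reg: "regular_on ?W (\<lambda>x. G (?F x) $ i)" for i
      by (rule regular_on_compose[OF G_regular])
        (auto intro: regular_on_subset[OF regular_on_psi_map])
    have "G (?F x) $ i = x $ i" for i
    proof (rule regular_on_eq_if_eq_on_open_reals[OF W reg regular_on_component
          open_positive_orthant positive_orthant_nonempty])
      fix y :: "real ^ 'n"
      assume y: "y \<in> positive_orthant" "complex_vec y \<in> ?W"
      then show "G (?F (complex_vec y)) $ i = complex_vec y $ i"
        using G_moment[OF y(1)] psi_map_complex_vec[OF y(1), of A w] by simp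
    qed (use x in simp)
    then show ?thesis unfolding vec_eq_iff by blast
  qed
  \<comment> \<open>Here the nonempty open set of real points is \<open>moment_image\<close>, on
    which \<open>G\<close> returns a positive preimage.\<close>
  have FG: "?F (G y) = y" if y: "y \<in> V" "G y \<in> ?U" for y
  proof -
    let ?W = "{y \<in> V. G y \<in> ?U}"
    have W: "principal_open ?W"
      by (rule principal_open_preimage[OF V G_regular U])
    have reg: "regular_on ?W (\<lambda>y. ?F (G y) $ i)" for i
      by (rule regular_on_compose[OF regular_on_psi_map])
        (auto intro: regular_on_subset[OF G_regular])
    have "?F (G y) $ i = y $ i" for i
    proof (rule regular_on_eq_if_eq_on_open_reals[OF W reg regular_on_component
          open_moment_image moment_image_nonempty])
      fix u :: "real ^ 'n"
      assume u: "u \<in> moment_image" "complex_vec u \<in> ?W"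
      then obtain x where "x \<in> positive_orthant" "u = moment_map A w x"
        by (auto simp: moment_image_def)
      then show "?F (G (complex_vec u)) $ i = complex_vec u $ i"
        using G_moment[of x] psi_map_complex_vec[of x A w] u(2) by simp
    qed (use y in simp)
    then show ?thesis unfolding vec_eq_iff by blast
  qed
  have "rational_map V G"
    using x0(2) V G_regular by (auto simp: rational_map_iff)
  moreover have "?F ` ?U \<inter> V \<noteq> {}"
    using imageI[OF mem_U[OF x0(1)], of ?F] x0(2) unfolding F_x0 by blast
  moreover have "G ` V \<inter> ?U \<noteq> {}"
    using imageI[OF x0(2), of G] mem_U[OF x0(1)] unfolding G_moment[OF x0] by blast
  ultimately show ?thesis
    unfolding birational_isomorphism_def using rational_map_psi_map GF FG
    by (intro conjI exI[of _ V] exI[of _ G] ballI impI)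
qed

lemma rational_blending_if_birational_isomorphism:
  assumes bir: "birational_isomorphism (psi_dom A w) (psi_map A w)" and a: "a \<in> A"
  shows "rational_function_on (Delta A) (blending a)"
proof -
  let ?U = "psi_dom A w" and ?F = "psi_map A w"
  obtain V G where G: "rational_map V G" and ne: "G ` V \<inter> ?U \<noteq> {}"
    and GF: "\<And>x. x \<in> ?U \<Longrightarrow> ?F x \<in> V \<Longrightarrow> G (?F x) = x"
    using bir unfolding birational_isomorphism_def by blast
  have V: "principal_open V" "V \<noteq> {}" and G_regular: "\<And>i. regular_on V (\<lambda>y. G y $ i)"
    using G by (auto simp: rational_map_iff)
  \<comment> \<open>On this set the toric coordinates of \<open>G y\<close> are defined and form
    regular functions of \<open>y\<close>.\<close>
  define W where "W = {y \<in> V. G y \<in> ?U}"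
  have "principal_open W"
    unfolding W_def by (rule principal_open_preimage[OF V(1) G_regular principal_open_psi_dom])
  moreover have "W \<noteq> {}" using ne by (auto simp: W_def)
  ultimately have W: "principal_open W" "W \<noteq> {}" by auto
  have G_W: "regular_on W (\<lambda>y. G y $ i)" for i
    by (rule regular_on_subset[OF G_regular]) (auto simp: W_def)
  have "regular_on W (\<lambda>y. of_real (w a) * laurent_monomial (G y) a / laurent_poly A w (G y))"
    by (intro regular_on_divide regular_on_mult regular_on_const
        regular_on_laurent_monomial[OF G_W] regular_on_laurent_poly[OF G_W])
      (auto simp: W_def psi_dom_def)
  then obtain P Q where P: "polynomial_fun P" and Q: "polynomial_fun Q"
    and PQ: "\<forall>y\<in>W. Q y \<noteq> 0 \<and>
      of_real (w a) * laurent_monomial (G y) a / laurent_poly A w (G y) = P y / Q y"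
    unfolding regular_on_def by blast
  \<comment> \<open>Multiplying numerator and denominator by the conjugate of \<open>Q\<close> makes
    the denominator the real polynomial \<open>q\<close>, the squared modulus of \<open>Q\<close>.
    Where the fraction is real, the new numerator equals its real part \<open>p\<close>.\<close>
  define p where "p y = Re (P (complex_vec y)) * Re (Q (complex_vec y))
      + Im (P (complex_vec y)) * Im (Q (complex_vec y))" for y :: "real ^ 'n"
  define q where "q y = Re (Q (complex_vec y)) * Re (Q (complex_vec y))
      + Im (Q (complex_vec y)) * Im (Q (complex_vec y))" for y :: "real ^ 'n"
  have p: "polynomial_fun p" and q: "polynomial_fun q"
    unfolding p_def q_def
    by (intro polynomial_fun_add polynomial_fun_mult polynomial_fun_Re_Im P Q)+
  obtain y0 :: "real ^ 'n" where "complex_vec y0 \<in> W"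
    using principal_open_meets_open_reals[OF W open_UNIV UNIV_not_empty] by blast
  then have "Q (complex_vec y0) \<noteq> 0" using PQ by blast
  then have "q y0 \<noteq> 0" by (simp add: q_def complex_eq_iff)
  \<comment> \<open>The form without division makes sense at zeros of \<open>q\<close> too, so it
    can be extended by continuity. Membership in \<open>V\<close> suffices: \<open>G\<close> maps
    such a point back to its positive preimage in the domain of \<open>psi_map\<close>, which puts
    it in \<open>W\<close>.\<close>
  have eq_dense: "blending a y * q y = p y"
    if y: "y \<in> moment_image" "complex_vec y \<in> V" for y
  proof -
    obtain x where x: "x \<in> positive_orthant" "y = moment_map A w x"
      using y(1) by (auto simp: moment_image_def)
    have xU: "complex_vec x \<in> ?U"
      by (rule complex_vec_mem_psi_dom[of A w, OF finite_A nonempty_A w_pos x(1)])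
    have F_x: "?F (complex_vec x) = complex_vec y"
      unfolding x(2) by (rule psi_map_complex_vec[OF x(1)])
    then have G_y: "G (complex_vec y) = complex_vec x" using GF[OF xU] y(2) by simp
    then have yW: "complex_vec y \<in> W" using xU y(2) by (simp add: W_def)
    have Q_nz: "Q (complex_vec y) \<noteq> 0" using PQ yW by blast
    have "of_real (w a) * laurent_monomial (complex_vec x) a / laurent_poly A w (complex_vec x)
        = P (complex_vec y) / Q (complex_vec y)"
      using PQ yW G_y by metis
    then have "of_real (blending a y) = P (complex_vec y) / Q (complex_vec y)"
      by (simp add: x(2) blending_moment_map[OF x(1) a] laurent_monomial_complex_vec
          laurent_poly_complex_vec)
    then have "P (complex_vec y) = of_real (blending a y) * Q (complex_vec y)"
      using Q_nz by (simp add: field_simps)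
    then have "Re (P (complex_vec y)) = blending a y * Re (Q (complex_vec y))"
      "Im (P (complex_vec y)) = blending a y * Im (Q (complex_vec y))" by simp_all
    then show ?thesis by (simp add: p_def q_def algebra_simps)
  qed
  have "blending a y * q y = p y" if "y \<in> Delta A" for y
    by (rule eq_on_Delta_if_eq_on_dense[OF V _ _ eq_dense that])
      (intro continuous_on_mult continuous_on_blending[OF a] continuous_on_polynomial_fun p q)+
  then have "\<forall>y\<in>Delta A. q y \<noteq> 0 \<longrightarrow> blending a y = p y / q y"
    by (simp add: nonzero_eq_divide_eq)
  then show ?thesis
    unfolding rational_function_on_def using p q \<open>q y0 \<noteq> 0\<close> by blast
qed

end

theorem theorem3p9:
  fixes A :: "(int ^ 'n) set"
    and w :: "int ^ 'n \<Rightarrow> real"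
    and \<beta> :: "int ^ 'n \<Rightarrow> real ^ 'n \<Rightarrow> real"
  assumes "finite A" and "primitive A"
    and "\<forall>a\<in>A. 0 < w a"
    and "toric_patch A w \<beta>"
    and "proper_patch A \<beta>"
  shows "rational_linear_precision A \<beta> \<longleftrightarrow>
           birational_isomorphism (psi_dom A w) (psi_map A w)"
proof -
  interpret proper_toric_patch A w \<beta>
    using assms by unfold_locales auto
  show ?thesis
    unfolding rational_linear_precision_iff_blending
    using birational_isomorphism_if_rational_blending rational_blending_if_birational_isomorphism
    by blast
qed

end
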